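(* Let $M$ be an object of an abelian category $\mathcal{A}$. The following hold both with all words in parentheses omitted and with all of them included. (1) Assume that $\mathcal{A}$ is AB3*. If $M$ is (strongly) self-CS-Rickart and (strictly) SSIP-extending, then $M$ is (strongly) self-CS-Baer. The converse holds if $\mathrm{Soc}(M)$ is an essential subobject of $M$. (2) Assume that $\mathcal{A}$ is AB3. If $M$ is dual (strongly) self-CS-Rickart and (strictly) SSSP-lifting, then $M$ is dual (strongly) self-CS-Baer. The converse holds if $\mathrm{Rad}(M)$ is a superfluous subobject of $M$.
   Context: An abelian category is AB3 (AB3* ) if it has arbitrary coproducts (products); it then has arbitrary sums (intersections) of families of subobjects. A subobject $i:K\to M$ is fully invariant if for every $h:M\to M$ one has $hi=i\alpha$ for some $\alpha:K\to K$. A subobject $L$ of $M$ lies above a direct summand $K$ of $M$ if $K\subseteq L$ and $L/K$ is superfluous in $M/K$ (a subobject $A$ of $B$ is superfluous if $A+X=B$ implies $X=B$ for every subobject $X$ of $B$). $\mathrm{Soc}(M)$ is the sum of all simple subobjects of $M$ and $\mathrm{Rad}(M)$ is the intersection of all maximal subobjects of $M$. $M$ is (strongly) self-CS-Rickart if for every $f:M\to M$, $\mathrm{Ker}(f)$ is essential in a (fully invariant) direct summand of $M$; $M$ is dual (strongly) self-CS-Rickart if for every $f:M\to M$, $\mathrm{Im}(f)$ lies above a (fully invariant) direct summand of $M$. In an AB3* abelian category: $M$ is (strongly) self-CS-Baer if for every family $(f_i)_{i\in I}$ of endomorphisms of $M$, $\bigcap_{i\in I}\mathrm{Ker}(f_i)$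 is essential in a (fully invariant) direct summand of $M$; $M$ is (strictly) SSIP-extending if for any family of subobjects of $M$ which are essential in direct summands of $M$, their intersection is essential in a (fully invariant) direct summand of $M$. In an AB3 abelian category: $M$ is dual (strongly) self-CS-Baer if for every family $(f_i)_{i\in I}$ of endomorphisms of $M$, $\sum_{i\in I}\mathrm{Im}(f_i)$ lies above a (fully invariant) direct summand of $M$; $M$ is (strictly) SSSP-lifting if for any family of subobjects of $M$ which lie above direct summands of $M$, their sum lies above a (fully invariant) direct summand of $M$. *)

theory Defs
  imports "HOL-Algebra.Group" "HOL-Library.Equipollence"
begin

section \<open>Abelian categories\<close>

text \<open>
  Objects and arrows have carrier sets \<open>obj\<close> and \<open>arr\<close>. The sum \<open>add f g\<close> is only meaningful
  for parallel arrows, and \<open>zero A B\<close> is the zero arrow from \<open>A\<close> to \<open>B\<close>.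
\<close>

record ('o, 'm) cat =
  obj  :: "'o set"
  arr  :: "'m set"
  dom  :: "'m \<Rightarrow> 'o"
  cod  :: "'m \<Rightarrow> 'o"
  ident :: "'o \<Rightarrow> 'm"
  cmp  :: "'m \<Rightarrow> 'm \<Rightarrow> 'm" (infixl "\<odot>\<index>" 70)
  add  :: "'m \<Rightarrow> 'm \<Rightarrow> 'm"
  zero :: "'o \<Rightarrow> 'o \<Rightarrow> 'm"

definition Hom :: "('o, 'm) cat \<Rightarrow> 'o \<Rightarrow> 'o \<Rightarrow> 'm set" where
  "Hom C A B = {f \<in> arr C. dom C f = A \<and> cod C f = B}"

definition hom_group :: "('o, 'm) cat \<Rightarrow> 'o \<Rightarrow> 'o \<Rightarrow> 'm monoid" where
  "hom_group C A B = \<lparr>carrier = Hom C A B, mult = add C, one = zero C A B\<rparr>"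

locale category =
  fixes C :: "('o, 'm) cat" (structure)
  assumes dom_obj: "f \<in> arr C \<Longrightarrow> dom C f \<in> obj C"
    and cod_obj: "f \<in> arr C \<Longrightarrow> cod C f \<in> obj C"
    and ident_Hom: "A \<in> obj C \<Longrightarrow> ident C A \<in> Hom C A A"
    and cmp_Hom: "f \<in> Hom C A B \<Longrightarrow> g \<in> Hom C B D \<Longrightarrow> g \<odot> f \<in> Hom C A D"
    and cmp_ident_left: "f \<in> Hom C A B \<Longrightarrow> ident C B \<odot> f = f"
    and cmp_ident_right: "f \<in> Hom C A B \<Longrightarrow> f \<odot> ident C A = f"
    and cmp_assoc: "f \<in> Hom C A B \<Longrightarrow> g \<in> Hom C B D \<Longrightarrow> h \<in> Hom C D E \<Longrightarrow>
                      (h \<odot> g) \<odot> f = h \<odot> (g \<odot> f)"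

locale preadditive_category = category +
  assumes comm_group_Hom:
      "A \<in> obj C \<Longrightarrow> B \<in> obj C \<Longrightarrow> comm_group (hom_group C A B)"
    and cmp_add_left: "f \<in> Hom C A B \<Longrightarrow> g \<in> Hom C B D \<Longrightarrow> h \<in> Hom C B D \<Longrightarrow>
                         add C g h \<odot> f = add C (g \<odot> f) (h \<odot> f)"
    and cmp_add_right: "f \<in> Hom C A B \<Longrightarrow> g \<in> Hom C A B \<Longrightarrow> h \<in> Hom C B D \<Longrightarrow>
                          h \<odot> add C f g = add C (h \<odot> f) (h \<odot> g)"

definition is_mono :: "('o, 'm) cat \<Rightarrow> 'm \<Rightarrow> bool" where
  "is_mono C f \<longleftrightarrow> f \<in> arr C \<and>
     (\<forall>X \<in> obj C. \<forall>g \<in> Hom C X (dom C f). \<forall>h \<in> Hom C X (dom C f).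
        f \<odot>\<^bsub>C\<^esub> g = f \<odot>\<^bsub>C\<^esub> h \<longrightarrow> g = h)"

definition is_epi :: "('o, 'm) cat \<Rightarrow> 'm \<Rightarrow> bool" where
  "is_epi C f \<longleftrightarrow> f \<in> arr C \<and>
     (\<forall>X \<in> obj C. \<forall>g \<in> Hom C (cod C f) X. \<forall>h \<in> Hom C (cod C f) X.
        g \<odot>\<^bsub>C\<^esub> f = h \<odot>\<^bsub>C\<^esub> f \<longrightarrow> g = h)"

definition is_iso :: "('o, 'm) cat \<Rightarrow> 'm \<Rightarrow> bool" where
  "is_iso C f \<longleftrightarrow> f \<in> arr C \<and>
     (\<exists>g \<in> Hom C (cod C f) (dom C f).
        g \<odot>\<^bsub>C\<^esub> f = ident C (dom C f) \<and> f \<odot>\<^bsub>C\<^esub> g = ident C (cod C f))"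

definition is_zero_obj :: "('o, 'm) cat \<Rightarrow> 'o \<Rightarrow> bool" where
  "is_zero_obj C Z \<longleftrightarrow> Z \<in> obj C \<and>
     (\<forall>A \<in> obj C. (\<exists>!f. f \<in> Hom C Z A) \<and> (\<exists>!f. f \<in> Hom C A Z))"

definition is_kernel :: "('o, 'm) cat \<Rightarrow> 'm \<Rightarrow> 'm \<Rightarrow> bool" where
  "is_kernel C f k \<longleftrightarrow> f \<in> arr C \<and> k \<in> arr C \<and> cod C k = dom C f \<and>
     f \<odot>\<^bsub>C\<^esub> k = zero C (dom C k) (cod C f) \<and>
     (\<forall>X \<in> obj C. \<forall>g \<in> Hom C X (dom C f). f \<odot>\<^bsub>C\<^esub> g = zero C X (cod C f) \<longrightarrow>
        (\<exists>!h. h \<in> Hom C X (dom C k) \<and> k \<odot>\<^bsub>C\<^esub> h = g))"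

definition is_cokernel :: "('o, 'm) cat \<Rightarrow> 'm \<Rightarrow> 'm \<Rightarrow> bool" where
  "is_cokernel C f c \<longleftrightarrow> f \<in> arr C \<and> c \<in> arr C \<and> dom C c = cod C f \<and>
     c \<odot>\<^bsub>C\<^esub> f = zero C (dom C f) (cod C c) \<and>
     (\<forall>X \<in> obj C. \<forall>g \<in> Hom C (cod C f) X. g \<odot>\<^bsub>C\<^esub> f = zero C (dom C f) X \<longrightarrow>
        (\<exists>!h. h \<in> Hom C (cod C c) X \<and> h \<odot>\<^bsub>C\<^esub> c = g))"

definition is_image :: "('o, 'm) cat \<Rightarrow> 'm \<Rightarrow> 'm \<Rightarrow> bool" where
  "is_image C f m \<longleftrightarrow> (\<exists>c. is_cokernel C f c \<and> is_kernel C c m)"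

definition is_biproduct ::
  "('o, 'm) cat \<Rightarrow> 'o \<Rightarrow> 'o \<Rightarrow> 'o \<Rightarrow> 'm \<Rightarrow> 'm \<Rightarrow> 'm \<Rightarrow> 'm \<Rightarrow> bool" where
  "is_biproduct C A B P i j p q \<longleftrightarrow>
     i \<in> Hom C A P \<and> j \<in> Hom C B P \<and> p \<in> Hom C P A \<and> q \<in> Hom C P B \<and>
     p \<odot>\<^bsub>C\<^esub> i = ident C A \<and> q \<odot>\<^bsub>C\<^esub> j = ident C B \<and>
     p \<odot>\<^bsub>C\<^esub> j = zero C B A \<and> q \<odot>\<^bsub>C\<^esub> i = zero C A B \<and>
     add C (i \<odot>\<^bsub>C\<^esub> p) (j \<odot>\<^bsub>C\<^esub> q) = ident C P"

locale abelian_category = preadditive_category +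
  assumes ex_zero_obj: "\<exists>Z. is_zero_obj C Z"
    and ex_biproduct: "A \<in> obj C \<Longrightarrow> B \<in> obj C \<Longrightarrow> \<exists>P i j p q. is_biproduct C A B P i j p q"
    and ex_kernel: "f \<in> arr C \<Longrightarrow> \<exists>k. is_kernel C f k"
    and ex_cokernel: "f \<in> arr C \<Longrightarrow> \<exists>c. is_cokernel C f c"
    and mono_normal: "is_mono C m \<Longrightarrow> \<exists>f. is_kernel C f m"
    and epi_normal: "is_epi C e \<Longrightarrow> \<exists>f. is_cokernel C f e"

section \<open>Arbitrary products and coproducts\<close>

text \<open>
  As usual, ``arbitrary'' families are those indexed by small sets, relative to a universe \<open>U\<close>: the
  subsets of a Grothendieck universe \<open>U\<close> that are elements of it are those of cardinality
  smaller than that of \<open>U\<close>. Some size bound is indispensable, because a category having products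
  of all families indexed by sets as large as its set of arrows is a preorder, and so an abelian
  category of this kind has only zero objects. The only property of \<open>U\<close> that matters below is
  that it is infinite. No arrow or object is required to belong to \<open>U\<close>.
\<close>

definition small :: "'i set \<Rightarrow> 'i set \<Rightarrow> bool" where
  "small U I \<longleftrightarrow> I \<subseteq> U \<and> I \<prec> U"

definition is_product :: "('o, 'm) cat \<Rightarrow> 'i set \<Rightarrow> ('i \<Rightarrow> 'o) \<Rightarrow> 'o \<Rightarrow> ('i \<Rightarrow> 'm) \<Rightarrow> bool" where
  "is_product C I A P p \<longleftrightarrow> P \<in> obj C \<and> (\<forall>i \<in> I. p i \<in> Hom C P (A i)) \<and>
     (\<forall>X \<in> obj C. \<forall>f. (\<forall>i \<in> I. f i \<in> Hom C X (A i)) \<longrightarrow>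
        (\<exists>!h. h \<in> Hom C X P \<and> (\<forall>i \<in> I. p i \<odot>\<^bsub>C\<^esub> h = f i)))"

definition is_coproduct :: "('o, 'm) cat \<Rightarrow> 'i set \<Rightarrow> ('i \<Rightarrow> 'o) \<Rightarrow> 'o \<Rightarrow> ('i \<Rightarrow> 'm) \<Rightarrow> bool" where
  "is_coproduct C I A P j \<longleftrightarrow> P \<in> obj C \<and> (\<forall>i \<in> I. j i \<in> Hom C (A i) P) \<and>
     (\<forall>X \<in> obj C. \<forall>f. (\<forall>i \<in> I. f i \<in> Hom C (A i) X) \<longrightarrow>
        (\<exists>!h. h \<in> Hom C P X \<and> (\<forall>i \<in> I. h \<odot>\<^bsub>C\<^esub> j i = f i)))"

definition AB3_star :: "('o, 'm) cat \<Rightarrow> 'i set \<Rightarrow> bool" where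
  "AB3_star C U \<longleftrightarrow>
     (\<forall>I A. small U I \<and> (\<forall>i \<in> I. A i \<in> obj C) \<longrightarrow> (\<exists>P p. is_product C I A P p))"

definition AB3 :: "('o, 'm) cat \<Rightarrow> 'i set \<Rightarrow> bool" where
  "AB3 C U \<longleftrightarrow>
     (\<forall>I A. small U I \<and> (\<forall>i \<in> I. A i \<in> obj C) \<longrightarrow> (\<exists>P j. is_coproduct C I A P j))"

section \<open>Subobjects\<close>

text \<open>
  A subobject of \<open>M\<close> is given by a representing monomorphism into \<open>M\<close>. Two monomorphisms
  represent the same subobject iff each is below the other in the order \<open>sub_le\<close>; all notions
  below are invariant under this equivalence. Thus \<open>k\<close> represents the zero subobject iff its
  domain is a zero object, and the whole of \<open>M\<close> iff it is an isomorphism.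
\<close>

definition subobject :: "('o, 'm) cat \<Rightarrow> 'o \<Rightarrow> 'm \<Rightarrow> bool" where
  "subobject C M k \<longleftrightarrow> is_mono C k \<and> cod C k = M"

definition sub_le :: "('o, 'm) cat \<Rightarrow> 'm \<Rightarrow> 'm \<Rightarrow> bool" where
  "sub_le C k l \<longleftrightarrow> (\<exists>a \<in> Hom C (dom C k) (dom C l). k = l \<odot>\<^bsub>C\<^esub> a)"

text \<open>
  Intersections and sums of subobjects are infima and suprema in the ordered class of subobjects
  of \<open>M\<close>. They are expressed as relations, since they need not exist in general. In particular
  the socle is used in an AB3* category, and the radical in an AB3 category, where their
  existence is not automatic without further size restrictions.
\<close>

definition is_intersection :: "('o, 'm) cat \<Rightarrow> 'o \<Rightarrow> 'm set \<Rightarrow> 'm \<Rightarrow> bool" where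
  "is_intersection C M S k \<longleftrightarrow> subobject C M k \<and> (\<forall>s \<in> S. sub_le C k s) \<and>
     (\<forall>l. subobject C M l \<and> (\<forall>s \<in> S. sub_le C l s) \<longrightarrow> sub_le C l k)"

definition is_sum :: "('o, 'm) cat \<Rightarrow> 'o \<Rightarrow> 'm set \<Rightarrow> 'm \<Rightarrow> bool" where
  "is_sum C M S k \<longleftrightarrow> subobject C M k \<and> (\<forall>s \<in> S. sub_le C s k) \<and>
     (\<forall>l. subobject C M l \<and> (\<forall>s \<in> S. sub_le C s l) \<longrightarrow> sub_le C k l)"

definition essential :: "('o, 'm) cat \<Rightarrow> 'o \<Rightarrow> 'm \<Rightarrow> bool" where
  "essential C B a \<longleftrightarrow> subobject C B a \<and>
     (\<forall>x. subobject C B x \<and> (\<exists>z. is_intersection C B {a, x} z \<and> is_zero_obj C (dom C z)) \<longrightarrow>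
        is_zero_obj C (dom C x))"

definition superfluous :: "('o, 'm) cat \<Rightarrow> 'o \<Rightarrow> 'm \<Rightarrow> bool" where
  "superfluous C B a \<longleftrightarrow> subobject C B a \<and>
     (\<forall>x. subobject C B x \<and> (\<exists>s. is_sum C B {a, x} s \<and> is_iso C s) \<longrightarrow> is_iso C x)"

definition fully_invariant :: "('o, 'm) cat \<Rightarrow> 'o \<Rightarrow> 'm \<Rightarrow> bool" where
  "fully_invariant C M k \<longleftrightarrow> subobject C M k \<and>
     (\<forall>h \<in> Hom C M M. \<exists>a \<in> Hom C (dom C k) (dom C k). h \<odot>\<^bsub>C\<^esub> k = k \<odot>\<^bsub>C\<^esub> a)"

definition direct_summand :: "('o, 'm) cat \<Rightarrow> 'o \<Rightarrow> 'm \<Rightarrow> bool" where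
  "direct_summand C M k \<longleftrightarrow> subobject C M k \<and>
     (\<exists>l p q. subobject C M l \<and> is_biproduct C (dom C k) (dom C l) M k l p q)"

definition essential_in :: "('o, 'm) cat \<Rightarrow> 'm \<Rightarrow> 'm \<Rightarrow> bool" where
  "essential_in C k d \<longleftrightarrow>
     (\<exists>a \<in> Hom C (dom C k) (dom C d). k = d \<odot>\<^bsub>C\<^esub> a \<and> essential C (dom C d) a)"

text \<open>
  For subobjects \<open>l: L \<rightarrow> M\<close> and \<open>k: K \<rightarrow> M\<close> with \<open>K \<subseteq> L\<close> via \<open>a: K \<rightarrow> L\<close>, the arrows \<open>p\<close>, \<open>q\<close>
  and \<open>b\<close> are the projections \<open>M \<rightarrow> M/K\<close> and \<open>L \<rightarrow> L/K\<close> and the induced arrow \<open>L/K \<rightarrow> M/K\<close>.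
\<close>

definition lies_above :: "('o, 'm) cat \<Rightarrow> 'o \<Rightarrow> 'm \<Rightarrow> 'm \<Rightarrow> bool" where
  "lies_above C M l k \<longleftrightarrow> subobject C M l \<and> subobject C M k \<and>
     (\<exists>a \<in> Hom C (dom C k) (dom C l). k = l \<odot>\<^bsub>C\<^esub> a \<and>
        (\<exists>p q b. is_cokernel C k p \<and> is_cokernel C a q \<and>
           b \<in> Hom C (cod C q) (cod C p) \<and> b \<odot>\<^bsub>C\<^esub> q = p \<odot>\<^bsub>C\<^esub> l \<and>
           superfluous C (cod C p) b))"

definition simple_obj :: "('o, 'm) cat \<Rightarrow> 'o \<Rightarrow> bool" where
  "simple_obj C S \<longleftrightarrow> S \<in> obj C \<and> \<not> is_zero_obj C S \<and>
     (\<forall>k. subobject C S k \<longrightarrow> is_zero_obj C (dom C k) \<or> is_iso C k)"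

definition maximal_subobject :: "('o, 'm) cat \<Rightarrow> 'o \<Rightarrow> 'm \<Rightarrow> bool" where
  "maximal_subobject C M k \<longleftrightarrow> subobject C M k \<and> \<not> is_iso C k \<and>
     (\<forall>l. subobject C M l \<and> sub_le C k l \<longrightarrow> sub_le C l k \<or> is_iso C l)"

definition is_socle :: "('o, 'm) cat \<Rightarrow> 'o \<Rightarrow> 'm \<Rightarrow> bool" where
  "is_socle C M s \<longleftrightarrow> is_sum C M {k. subobject C M k \<and> simple_obj C (dom C k)} s"

definition is_radical :: "('o, 'm) cat \<Rightarrow> 'o \<Rightarrow> 'm \<Rightarrow> bool" where
  "is_radical C M r \<longleftrightarrow> is_intersection C M {k. maximal_subobject C M k} r"

section \<open>CS-Rickart and CS-Baer objects\<close>

definition ess_in_summand :: "('o, 'm) cat \<Rightarrow> 'o \<Rightarrow> 'm \<Rightarrow> bool" where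
  "ess_in_summand C M k \<longleftrightarrow> (\<exists>d. direct_summand C M d \<and> essential_in C k d)"

definition ess_in_fi_summand :: "('o, 'm) cat \<Rightarrow> 'o \<Rightarrow> 'm \<Rightarrow> bool" where
  "ess_in_fi_summand C M k \<longleftrightarrow>
     (\<exists>d. direct_summand C M d \<and> fully_invariant C M d \<and> essential_in C k d)"

definition above_summand :: "('o, 'm) cat \<Rightarrow> 'o \<Rightarrow> 'm \<Rightarrow> bool" where
  "above_summand C M l \<longleftrightarrow> (\<exists>d. direct_summand C M d \<and> lies_above C M l d)"

definition above_fi_summand :: "('o, 'm) cat \<Rightarrow> 'o \<Rightarrow> 'm \<Rightarrow> bool" where
  "above_fi_summand C M l \<longleftrightarrow>
     (\<exists>d. direct_summand C M d \<and> fully_invariant C M d \<and> lies_above C M l d)"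

definition self_CS_Rickart :: "('o, 'm) cat \<Rightarrow> 'o \<Rightarrow> bool" where
  "self_CS_Rickart C M \<longleftrightarrow>
     (\<forall>f \<in> Hom C M M. \<exists>k. is_kernel C f k \<and> ess_in_summand C M k)"

definition strongly_self_CS_Rickart :: "('o, 'm) cat \<Rightarrow> 'o \<Rightarrow> bool" where
  "strongly_self_CS_Rickart C M \<longleftrightarrow>
     (\<forall>f \<in> Hom C M M. \<exists>k. is_kernel C f k \<and> ess_in_fi_summand C M k)"

definition dual_self_CS_Rickart :: "('o, 'm) cat \<Rightarrow> 'o \<Rightarrow> bool" where
  "dual_self_CS_Rickart C M \<longleftrightarrow>
     (\<forall>f \<in> Hom C M M. \<exists>l. is_image C f l \<and> above_summand C M l)"

definition dual_strongly_self_CS_Rickart :: "('o, 'm) cat \<Rightarrow> 'o \<Rightarrow> bool" where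
  "dual_strongly_self_CS_Rickart C M \<longleftrightarrow>
     (\<forall>f \<in> Hom C M M. \<exists>l. is_image C f l \<and> above_fi_summand C M l)"

text \<open>
  In the CS-Baer conditions the intersection (sum) is taken over all monomorphisms representing
  one of the kernels (images), which avoids choosing representatives.
\<close>

definition self_CS_Baer :: "('o, 'm) cat \<Rightarrow> 'i set \<Rightarrow> 'o \<Rightarrow> bool" where
  "self_CS_Baer C U M \<longleftrightarrow>
     (\<forall>I f. small U I \<and> (\<forall>i \<in> I. f i \<in> Hom C M M) \<longrightarrow>
        (\<exists>k. is_intersection C M {j. \<exists>i \<in> I. is_kernel C (f i) j} k \<and> ess_in_summand C M k))"

definition strongly_self_CS_Baer :: "('o, 'm) cat \<Rightarrow> 'i set \<Rightarrow> 'o \<Rightarrow> bool" where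
  "strongly_self_CS_Baer C U M \<longleftrightarrow>
     (\<forall>I f. small U I \<and> (\<forall>i \<in> I. f i \<in> Hom C M M) \<longrightarrow>
        (\<exists>k. is_intersection C M {j. \<exists>i \<in> I. is_kernel C (f i) j} k \<and> ess_in_fi_summand C M k))"

definition dual_self_CS_Baer :: "('o, 'm) cat \<Rightarrow> 'i set \<Rightarrow> 'o \<Rightarrow> bool" where
  "dual_self_CS_Baer C U M \<longleftrightarrow>
     (\<forall>I f. small U I \<and> (\<forall>i \<in> I. f i \<in> Hom C M M) \<longrightarrow>
        (\<exists>l. is_sum C M {j. \<exists>i \<in> I. is_image C (f i) j} l \<and> above_summand C M l))"

definition dual_strongly_self_CS_Baer :: "('o, 'm) cat \<Rightarrow> 'i set \<Rightarrow> 'o \<Rightarrow> bool" where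
  "dual_strongly_self_CS_Baer C U M \<longleftrightarrow>
     (\<forall>I f. small U I \<and> (\<forall>i \<in> I. f i \<in> Hom C M M) \<longrightarrow>
        (\<exists>l. is_sum C M {j. \<exists>i \<in> I. is_image C (f i) j} l \<and> above_fi_summand C M l))"

definition SSIP_extending :: "('o, 'm) cat \<Rightarrow> 'i set \<Rightarrow> 'o \<Rightarrow> bool" where
  "SSIP_extending C U M \<longleftrightarrow>
     (\<forall>I s. small U I \<and> (\<forall>i \<in> I. subobject C M (s i) \<and> ess_in_summand C M (s i)) \<longrightarrow>
        (\<exists>k. is_intersection C M (s ` I) k \<and> ess_in_summand C M k))"

definition strictly_SSIP_extending :: "('o, 'm) cat \<Rightarrow> 'i set \<Rightarrow> 'o \<Rightarrow> bool" where
  "strictly_SSIP_extending C U M \<longleftrightarrow>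
     (\<forall>I s. small U I \<and> (\<forall>i \<in> I. subobject C M (s i) \<and> ess_in_summand C M (s i)) \<longrightarrow>
        (\<exists>k. is_intersection C M (s ` I) k \<and> ess_in_fi_summand C M k))"

definition SSSP_lifting :: "('o, 'm) cat \<Rightarrow> 'i set \<Rightarrow> 'o \<Rightarrow> bool" where
  "SSSP_lifting C U M \<longleftrightarrow>
     (\<forall>I s. small U I \<and> (\<forall>i \<in> I. subobject C M (s i) \<and> above_summand C M (s i)) \<longrightarrow>
        (\<exists>l. is_sum C M (s ` I) l \<and> above_summand C M l))"

definition strictly_SSSP_lifting :: "('o, 'm) cat \<Rightarrow> 'i set \<Rightarrow> 'o \<Rightarrow> bool" where
  "strictly_SSSP_lifting C U M \<longleftrightarrow>
     (\<forall>I s. small U I \<and> (\<forall>i \<in> I. subobject C M (s i) \<and> above_summand C M (s i)) \<longrightarrow>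
        (\<exists>l. is_sum C M (s ` I) l \<and> above_fi_summand C M l))"

end

theory Submission
  imports Defs
begin

text \<open>
  A direct summand of \<open>M\<close> is the kernel (and the image) of an idempotent, so the Baer condition
  controls intersections of summands. To pass from summands \<open>D\<^sub>i\<close> to subobjects \<open>S\<^sub>i\<close> essential in them,
  let \<open>p\<^sub>i\<close> be a retraction onto \<open>D\<^sub>i\<close>. The preimage of \<open>S\<^sub>i\<close> under \<open>p\<^sub>i\<close> is essential in \<open>M\<close>, hence
  contains every simple subobject and so the socle; it meets \<open>D\<^sub>i\<close> exactly in \<open>S\<^sub>i\<close>. Thus
  \<open>Soc M \<inter> \<Inter>\<^sub>i D\<^sub>i \<subseteq> \<Inter>\<^sub>i S\<^sub>i\<close>, and the left side is essential in \<open>\<Inter>\<^sub>i D\<^sub>i\<close> when \<open>Soc M\<close> is essential in \<open>M\<close>.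
  No subobject of the socle is required to contain a simple one, which could fail without AB5.
  The second part is the same argument in the opposite category, applied to the cokernels.
\<close>

text \<open>The obstacle is that an intersection of infinitely many essential subobjects need not be
  essential. The socle removes it by being one essential subobject that lies below all the others,
  and it enters \<open>essential_intersection\<close> as some \<open>r\<close> with these two
  properties. For that reading the notions become conditions on arrows: L lies above K iff M/K
  \<rightarrow> M/L is essential in the opposite category, and a sum of subobjects is there an
  intersection of quotients. Pullbacks are avoided in the same spirit: the preimage of E under M
  \<rightarrow> N is the kernel of M \<rightarrow> N \<rightarrow> N/E, and the intersection of the
  S_i is the kernel of the arrow from M to the product of the M/S_i, which is where
  \<open>AB3_star\<close> enters. The Rickart half of the converse comes from one-member families,
  which are small because the universe is infinite.\<close>

lemma small_singleton: "infinite U \<Longrightarrow> i \<in> U \<Longrightarrow> small U {i}"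
  by (simp add: small_def finite_lesspoll_infinite)

lemma HomD:
  "f \<in> Hom C A B \<Longrightarrow> f \<in> arr C" "f \<in> Hom C A B \<Longrightarrow> dom C f = A" "f \<in> Hom C A B \<Longrightarrow> cod C f = B"
  by (auto simp: Hom_def)

lemma arr_Hom: "f \<in> arr C \<Longrightarrow> f \<in> Hom C (dom C f) (cod C f)"
  by (auto simp: Hom_def)

section \<open>Monomorphisms and epimorphisms without additive structure\<close>

context category
begin

lemma Hom_obj:
  assumes "f \<in> Hom C A B"
  shows "A \<in> obj C" "B \<in> obj C"
  using assms dom_obj cod_obj by (auto simp: Hom_def)

lemma is_monoD:
  assumes "is_mono C f" "f \<in> Hom C A B" "g \<in> Hom C X A" "h \<in> Hom C X A" "f \<odot> g = f \<odot> h"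
  shows "g = h"
  using assms Hom_obj(1)[OF assms(3)] HomD(2)[OF assms(2)] unfolding is_mono_def by blast

lemma is_epiD:
  assumes "is_epi C f" "f \<in> Hom C A B" "g \<in> Hom C B X" "h \<in> Hom C B X" "g \<odot> f = h \<odot> f"
  shows "g = h"
  using assms Hom_obj(2)[OF assms(3)] HomD(3)[OF assms(2)] unfolding is_epi_def by blast

lemma is_mono_cmp:
  assumes "is_mono C f" "is_mono C g" "f \<in> Hom C A B" "g \<in> Hom C B D"
  shows "is_mono C (g \<odot> f)"
proof -
  have gf: "g \<odot> f \<in> Hom C A D" using assms cmp_Hom by blast
  have "u = v" if "u \<in> Hom C X A" "v \<in> Hom C X A" "g \<odot> f \<odot> u = g \<odot> f \<odot> v" for X u v
  proof -
    have "g \<odot> (f \<odot> u) = g \<odot> (f \<odot> v)" using that assms cmp_assoc by simp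
    then have "f \<odot> u = f \<odot> v" using is_monoD[OF assms(2,4)] that assms cmp_Hom by blast
    then show ?thesis using is_monoD[OF assms(1,3)] that by blast
  qed
  then show ?thesis using gf unfolding is_mono_def by (auto dest: HomD)
qed

lemma is_mono_cmpD:
  assumes "is_mono C (g \<odot> f)" "f \<in> Hom C A B" "g \<in> Hom C B D"
  shows "is_mono C f"
proof -
  have gf: "g \<odot> f \<in> Hom C A D" using assms cmp_Hom by blast
  have "u = v" if "u \<in> Hom C X A" "v \<in> Hom C X A" "f \<odot> u = f \<odot> v" for X u v
    using is_monoD[OF assms(1) gf that(1,2)] that assms cmp_assoc by simp
  then show ?thesis using assms(2) unfolding is_mono_def by (auto dest: HomD)
qed

lemma is_mono_ident: "A \<in> obj C \<Longrightarrow> is_mono C (ident C A)"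
  using ident_Hom[of A] unfolding is_mono_def by (auto dest: HomD simp: cmp_ident_left)

lemma is_mono_split:
  assumes "f \<in> Hom C A B" "g \<in> Hom C B A" "g \<odot> f = ident C A"
  shows "is_mono C f"
  using assms is_mono_cmpD is_mono_ident Hom_obj(1) by metis

end

section \<open>Zero arrows and differences of arrows\<close>

context preadditive_category
begin

lemma group_Hom: "A \<in> obj C \<Longrightarrow> B \<in> obj C \<Longrightarrow> group (hom_group C A B)"
  using comm_group_Hom comm_group.axioms(2) by blast

lemma zero_Hom: "A \<in> obj C \<Longrightarrow> B \<in> obj C \<Longrightarrow> zero C A B \<in> Hom C A B"
  using monoid.one_closed[OF group.is_monoid[OF group_Hom]] by (simp add: hom_group_def)

lemma add_Hom: "f \<in> Hom C A B \<Longrightarrow> g \<in> Hom C A B \<Longrightarrow> add C f g \<in> Hom C A B"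
  using monoid.m_closed[OF group.is_monoid[OF group_Hom[of A B]], of f g] Hom_obj[of f A B]
  by (simp add: hom_group_def)

lemma add_zero_right: "f \<in> Hom C A B \<Longrightarrow> add C f (zero C A B) = f"
  using monoid.r_one[OF group.is_monoid[OF group_Hom[of A B]], of f] Hom_obj[of f A B]
  by (simp add: hom_group_def)

lemma add_idem_zero: "f \<in> Hom C A B \<Longrightarrow> add C f f = f \<Longrightarrow> f = zero C A B"
  using group.l_cancel_one[OF group_Hom[of A B], of f f] Hom_obj[of f A B]
  by (simp add: hom_group_def)

text \<open>Bilinearity makes the composite with a zero arrow equal to its own double, and
  cancellation in the Hom group leaves only zero.\<close>

lemma cmp_zero_right:
  assumes f: "f \<in> Hom C A B" and X: "X \<in> obj C"
  shows "f \<odot> zero C X A = zero C X B"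
proof -
  have z: "zero C X A \<in> Hom C X A" using X Hom_obj[OF f] zero_Hom by blast
  show ?thesis
    using add_idem_zero[OF cmp_Hom[OF z f]] cmp_add_right[OF z z f] add_zero_right[OF z] by simp
qed

lemma cmp_zero_left:
  assumes f: "f \<in> Hom C A B" and X: "X \<in> obj C"
  shows "zero C B X \<odot> f = zero C A X"
proof -
  have z: "zero C B X \<in> Hom C B X" using X Hom_obj[OF f] zero_Hom by blast
  show ?thesis
    using add_idem_zero[OF cmp_Hom[OF f z]] cmp_add_left[OF f z z] add_zero_right[OF z] by simp
qed

lemma is_mono_zeroD:
  assumes f: "is_mono C f" "f \<in> Hom C A B" and g: "g \<in> Hom C X A" "f \<odot> g = zero C X B"
  shows "g = zero C X A"
proof -
  have "X \<in> obj C" "A \<in> obj C" using Hom_obj[OF g(1)] by auto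
  then show ?thesis using is_monoD[OF f g(1) zero_Hom] g(2) cmp_zero_right[OF f(2)] by simp
qed

text \<open>The record \<open>cat\<close> has no subtraction. The last clause leads back from a
  vanishing difference to an equality, as \<open>is_monoI_zero\<close> requires.\<close>

lemma ex_neg:
  assumes "h \<in> Hom C A B"
  obtains n where "n \<in> Hom C A B" "add C h n = zero C A B"
    "\<And>g. g \<in> Hom C A B \<Longrightarrow> add C g n = zero C A B \<Longrightarrow> g = h"
proof -
  interpret G: comm_group "hom_group C A B" using assms comm_group_Hom Hom_obj by blast
  let ?n = "inv\<^bsub>hom_group C A B\<^esub> h"
  have h: "h \<in> carrier (hom_group C A B)" using assms by (simp add: hom_group_def)
  then have "?n \<in> carrier (hom_group C A B)" "h \<otimes>\<^bsub>hom_group C A B\<^esub> ?n = \<one>\<^bsub>hom_group C A B\<^esub>"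
    by simp_all
  moreover have "g = h" if "g \<in> carrier (hom_group C A B)"
    "g \<otimes>\<^bsub>hom_group C A B\<^esub> ?n = \<one>\<^bsub>hom_group C A B\<^esub>" for g
    using that h by (metis G.inv_equality G.inv_inv G.inv_closed)
  ultimately show thesis using that by (simp add: hom_group_def)
qed

lemma is_monoI_zero:
  assumes f: "f \<in> Hom C A B"
    and z: "\<And>X g. g \<in> Hom C X A \<Longrightarrow> f \<odot> g = zero C X B \<Longrightarrow> g = zero C X A"
  shows "is_mono C f"
proof -
  have "g = h" if g: "g \<in> Hom C X A" and h: "h \<in> Hom C X A" and eq: "f \<odot> g = f \<odot> h" for X g h
  proof -
    obtain n where n: "n \<in> Hom C X A" "add C h n = zero C X A"
      "\<And>g. g \<in> Hom C X A \<Longrightarrow> add C g n = zero C X A \<Longrightarrow> g = h"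
      using ex_neg[OF h] by blast
    have "f \<odot> add C g n = f \<odot> add C h n"
      using cmp_add_right[OF g n(1) f] cmp_add_right[OF h n(1) f] eq by simp
    also have "\<dots> = zero C X B" using n(2) cmp_zero_right[OF f] Hom_obj(1)[OF g] by simp
    finally show ?thesis using z n g add_Hom by blast
  qed
  then show ?thesis using f unfolding is_mono_def by (auto dest: HomD)
qed

end

section \<open>The opposite category\<close>

text \<open>Statements on epimorphisms, cokernels and coproducts are obtained as instances, for this
  category, of those on monomorphisms, kernels and products. The rules below are mostly equations
  between predicates, so that the simplifier can translate such an instance back.\<close>

definition opcat :: "('o, 'm) cat \<Rightarrow> ('o, 'm) cat" where
  "opcat C = C\<lparr>dom := cod C, cod := dom C, cmp := \<lambda>f g. g \<odot>\<^bsub>C\<^esub> f, zero := \<lambda>A B. zero C B A\<rparr>"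

lemma opcat_simps [simp]:
  "obj (opcat C) = obj C" "arr (opcat C) = arr C" "dom (opcat C) = cod C" "cod (opcat C) = dom C"
  "ident (opcat C) = ident C" "f \<odot>\<^bsub>opcat C\<^esub> g = g \<odot>\<^bsub>C\<^esub> f" "add (opcat C) = add C"
  "zero (opcat C) A B = zero C B A"
  by (simp_all add: opcat_def)

lemma Hom_opcat [simp]: "Hom (opcat C) A B = Hom C B A"
  by (auto simp: Hom_def)

lemma is_mono_opcat [simp]: "is_mono (opcat C) = is_epi C"
  and is_epi_opcat [simp]: "is_epi (opcat C) = is_mono C"
  by (simp_all add: fun_eq_iff is_mono_def is_epi_def)

lemma is_kernel_opcat [simp]: "is_kernel (opcat C) = is_cokernel C"
  and is_cokernel_opcat [simp]: "is_cokernel (opcat C) = is_kernel C"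
  by (simp_all add: fun_eq_iff is_kernel_def is_cokernel_def)

lemma is_zero_obj_opcat [simp]: "is_zero_obj (opcat C) = is_zero_obj C"
  by (simp add: fun_eq_iff is_zero_obj_def conj_commute)

lemma is_product_opcat [simp]: "is_product (opcat C) = is_coproduct C"
  by (simp add: fun_eq_iff is_product_def is_coproduct_def)

lemma AB3_star_opcat [simp]: "AB3_star (opcat C) = AB3 C"
  by (simp add: fun_eq_iff AB3_star_def AB3_def)

lemma is_biproduct_opcat [simp]:
  "is_biproduct (opcat C) A B P i j p q = is_biproduct C A B P p q i j"
  by (auto simp: is_biproduct_def)

lemma abelian_category_opcat:
  assumes "abelian_category C"
  shows "abelian_category (opcat C)"
proof -
  interpret abelian_category C by fact
  have [simp]: "hom_group (opcat C) A B = hom_group C B A" for A B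
    by (simp add: hom_group_def)
  have cat: "category (opcat C)"
    by standard (auto simp: dom_obj cod_obj cmp_ident_left cmp_ident_right cmp_assoc
        intro: cmp_Hom ident_Hom[simplified])
  have pre: "preadditive_category (opcat C)"
    by (intro preadditive_category.intro preadditive_category_axioms.intro cat)
      (simp_all add: comm_group_Hom cmp_add_left cmp_add_right)
  have "\<exists>P i j p q. is_biproduct C A B P p q i j" if "A \<in> obj C" "B \<in> obj C" for A B
    using ex_biproduct[OF that] by blast
  then show ?thesis
    by (intro abelian_category.intro abelian_category_axioms.intro pre)
      (simp_all add: ex_zero_obj ex_kernel ex_cokernel mono_normal epi_normal)
qed

section \<open>Kernels, cokernels and zero objects\<close>

context abelian_category
begin

lemma abelian_category_op: "abelian_category (opcat C)"
  by (rule abelian_category_opcat) unfold_locales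

lemma is_epi_cmp:
  assumes "is_epi C f" "is_epi C g" "f \<in> Hom C A B" "g \<in> Hom C B D"
  shows "is_epi C (g \<odot> f)"
proof -
  interpret op: abelian_category "opcat C" by (rule abelian_category_op)
  show ?thesis using op.is_mono_cmp[of g f D B A] assms by simp
qed

lemma is_epi_cmpD:
  assumes "is_epi C (g \<odot> f)" "f \<in> Hom C A B" "g \<in> Hom C B D"
  shows "is_epi C g"
proof -
  interpret op: abelian_category "opcat C" by (rule abelian_category_op)
  show ?thesis using op.is_mono_cmpD[of f g D B A] assms by simp
qed

lemma is_epi_zeroD:
  assumes "is_epi C f" "f \<in> Hom C A B" "g \<in> Hom C B X" "g \<odot> f = zero C A X"
  shows "g = zero C B X"
proof -
  interpret op: abelian_category "opcat C" by (rule abelian_category_op)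
  show ?thesis using op.is_mono_zeroD[of f B A g X] assms by simp
qed

lemma is_epiI_zero:
  assumes "f \<in> Hom C A B"
    and "\<And>X g. g \<in> Hom C B X \<Longrightarrow> g \<odot> f = zero C A X \<Longrightarrow> g = zero C B X"
  shows "is_epi C f"
proof -
  interpret op: abelian_category "opcat C" by (rule abelian_category_op)
  show ?thesis using op.is_monoI_zero[of f B A] assms by simp
qed

lemma is_kernelD:
  assumes "is_kernel C f k" "f \<in> Hom C A B"
  shows "k \<in> Hom C (dom C k) A" "is_mono C k" "f \<odot> k = zero C (dom C k) B"
    "\<And>X g. g \<in> Hom C X A \<Longrightarrow> f \<odot> g = zero C X B \<Longrightarrow> \<exists>h \<in> Hom C X (dom C k). g = k \<odot> h"
proof -
  have f: "dom C f = A" "cod C f = B" using HomD[OF assms(2)] by auto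
  show k: "k \<in> Hom C (dom C k) A" and fk: "f \<odot> k = zero C (dom C k) B"
    using assms(1) f unfolding is_kernel_def Hom_def by auto
  have ex1: "\<exists>!h. h \<in> Hom C X (dom C k) \<and> k \<odot> h = g" if "g \<in> Hom C X A" "f \<odot> g = zero C X B" for X g
    using assms(1) f that Hom_obj(1) unfolding is_kernel_def by auto
  then show "\<exists>h \<in> Hom C X (dom C k). g = k \<odot> h" if "g \<in> Hom C X A" "f \<odot> g = zero C X B" for X g
    using that by blast
  \<comment> \<open>Both \<open>u\<close> and \<open>v\<close> factor the same arrow, which
    \<open>f\<close> kills; uniqueness of that factorization makes \<open>k\<close> mono.\<close>
  have "u = v" if u: "u \<in> Hom C X (dom C k)" and v: "v \<in> Hom C X (dom C k)" and "k \<odot> u = k \<odot> v" for X u v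
  proof -
    have "f \<odot> (k \<odot> u) = zero C X B"
      using cmp_assoc[OF u k assms(2)] fk cmp_zero_left[OF u] Hom_obj(2)[OF assms(2)] by simp
    then show ?thesis using ex1[OF cmp_Hom[OF u k]] u v that(3) by metis
  qed
  then show "is_mono C k" using k unfolding is_mono_def by (auto dest: HomD)
qed

lemma is_kernelI:
  assumes "k \<in> Hom C K A" "is_mono C k" "f \<in> Hom C A B" "f \<odot> k = zero C K B"
    and "\<And>X g. g \<in> Hom C X A \<Longrightarrow> f \<odot> g = zero C X B \<Longrightarrow> \<exists>h \<in> Hom C X K. g = k \<odot> h"
  shows "is_kernel C f k"
proof -
  have "\<exists>!h. h \<in> Hom C X K \<and> k \<odot> h = g" if "g \<in> Hom C X A" "f \<odot> g = zero C X B" for X g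
    using assms(5)[OF that] is_monoD[OF assms(2,1)] by metis
  then show ?thesis using HomD[OF assms(1)] HomD[OF assms(3)] assms(4) unfolding is_kernel_def by simp
qed

lemma is_cokernelD:
  assumes "is_cokernel C f c" "f \<in> Hom C A B"
  shows "c \<in> Hom C B (cod C c)" "is_epi C c" "c \<odot> f = zero C A (cod C c)"
    "\<And>X g. g \<in> Hom C B X \<Longrightarrow> g \<odot> f = zero C A X \<Longrightarrow> \<exists>h \<in> Hom C (cod C c) X. g = h \<odot> c"
proof -
  interpret op: abelian_category "opcat C" by (rule abelian_category_op)
  note * = op.is_kernelD[of f c B A, simplified, OF assms]
  show "c \<in> Hom C B (cod C c)" "is_epi C c" "c \<odot> f = zero C A (cod C c)"
    by (fact *)+
  show "\<exists>h \<in> Hom C (cod C c) X. g = h \<odot> c" if "g \<in> Hom C B X" "g \<odot> f = zero C A X" for X g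
    using *(4)[OF that] .
qed

lemma is_cokernelI:
  assumes "c \<in> Hom C B Q" "is_epi C c" "f \<in> Hom C A B" "c \<odot> f = zero C A Q"
    and "\<And>X g. g \<in> Hom C B X \<Longrightarrow> g \<odot> f = zero C A X \<Longrightarrow> \<exists>h \<in> Hom C Q X. g = h \<odot> c"
  shows "is_cokernel C f c"
proof -
  interpret op: abelian_category "opcat C" by (rule abelian_category_op)
  show ?thesis using op.is_kernelI[of c Q B f A] assms by simp
qed

lemma ex_kernel_Hom: "f \<in> Hom C A B \<Longrightarrow> \<exists>k. is_kernel C f k"
  using ex_kernel HomD(1) by metis

lemma ex_cokernel_Hom: "f \<in> Hom C A B \<Longrightarrow> \<exists>c. is_cokernel C f c"
  using ex_cokernel HomD(1) by metis

text \<open>Normality gives some \<open>f\<close> with kernel \<open>m\<close>. As \<open>f\<close>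
  kills \<open>m\<close>, it factors through \<open>c\<close>; so whatever \<open>c\<close> kills is
  killed by \<open>f\<close> and hence factors through \<open>m\<close>.\<close>

lemma is_kernel_cokernel:
  assumes m: "is_mono C m" and c: "is_cokernel C m c"
  shows "is_kernel C c m"
proof -
  obtain f where f: "is_kernel C f m" using mono_normal[OF m] by blast
  define A B K Q where "A = dom C f" and "B = cod C f" and "K = dom C m" and "Q = cod C c"
  have fH: "f \<in> Hom C A B" using f unfolding A_def B_def by (simp add: is_kernel_def arr_Hom)
  note k = is_kernelD[OF f fH, folded K_def]
  note q = is_cokernelD[OF c k(1), folded Q_def]
  obtain h where h: "h \<in> Hom C Q B" "f = h \<odot> c" using q(4)[OF fH k(3)] by blast
  show ?thesis
  proof (rule is_kernelI[OF k(1,2) q(1,3)])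
    fix X g assume g: "g \<in> Hom C X A" "c \<odot> g = zero C X Q"
    have "f \<odot> g = zero C X B"
      using cmp_assoc[OF g(1) q(1) h(1)] g(2) cmp_zero_right[OF h(1)] Hom_obj(1)[OF g(1)] h(2) by simp
    then show "\<exists>h \<in> Hom C X K. g = m \<odot> h" using k(4)[OF g(1)] by blast
  qed
qed

lemma is_cokernel_kernel:
  assumes "is_epi C e" "is_kernel C e k"
  shows "is_cokernel C k e"
proof -
  interpret op: abelian_category "opcat C" by (rule abelian_category_op)
  show ?thesis using op.is_kernel_cokernel assms by simp
qed

text \<open>The cokernel of an epimorphism is zero, so it kills the identity of the codomain. Since
  \<open>f\<close> is the kernel of that cokernel, the identity factors through \<open>f\<close>;
  being mono makes this right inverse two-sided.\<close>

lemma is_isoI: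
  assumes m: "is_mono C f" and e: "is_epi C f"
  shows "is_iso C f"
proof -
  define A B where "A = dom C f" and "B = cod C f"
  have f: "f \<in> Hom C A B" using m unfolding A_def B_def by (simp add: is_mono_def arr_Hom)
  obtain c where c0: "is_cokernel C f c" using ex_cokernel_Hom[OF f] by blast
  define Q where "Q = cod C c"
  note c = c0 is_cokernelD(1,3)[OF c0 f, folded Q_def]
  have B: "B \<in> obj C" using Hom_obj[OF f] by blast
  have "c = zero C B Q" using is_epi_zeroD[OF e f] c by blast
  then have "c \<odot> ident C B = zero C B Q" using cmp_ident_right[OF c(2)] by simp
  then obtain u where u: "u \<in> Hom C B A" "f \<odot> u = ident C B"
    using is_kernelD(4)[OF is_kernel_cokernel[OF m c(1)] c(2) ident_Hom[OF B]] A_def by auto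
  have "f \<odot> (u \<odot> f) = f \<odot> ident C A"
    using cmp_assoc[OF f u(1) f] u(2) cmp_ident_left[OF f] cmp_ident_right[OF f] by simp
  then have "u \<odot> f = ident C A"
    using is_monoD[OF m f cmp_Hom[OF f u(1)] ident_Hom] Hom_obj[OF f] by blast
  then show ?thesis using u HomD(1)[OF f] unfolding is_iso_def A_def B_def by blast
qed

lemma is_isoD:
  assumes "is_iso C f" "f \<in> Hom C A B"
  obtains g where "g \<in> Hom C B A" "g \<odot> f = ident C A" "f \<odot> g = ident C B"
proof -
  obtain g where "g \<in> Hom C B A" "g \<odot> f = ident C A" "f \<odot> g = ident C B"
    using assms(1) HomD(2,3)[OF assms(2)] by (auto simp: is_iso_def)
  then show thesis by (rule that)
qed

lemma is_iso_is_mono: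
  assumes "is_iso C f"
  shows "is_mono C f"
proof -
  have f: "f \<in> Hom C (dom C f) (cod C f)" using assms by (simp add: is_iso_def arr_Hom)
  show ?thesis by (rule is_isoD[OF assms f], rule is_mono_split[OF f])
qed

lemma is_epi_split:
  assumes "f \<in> Hom C A B" "g \<in> Hom C B A" "f \<odot> g = ident C B"
  shows "is_epi C f"
proof -
  interpret op: abelian_category "opcat C" by (rule abelian_category_op)
  show ?thesis using op.is_mono_split[of f B A g] assms by simp
qed

lemma is_iso_is_epi:
  assumes "is_iso C f"
  shows "is_epi C f"
proof -
  have f: "f \<in> Hom C (dom C f) (cod C f)" using assms by (simp add: is_iso_def arr_Hom)
  show ?thesis by (rule is_isoD[OF assms f], rule is_epi_split[OF f])
qed

text \<open>The mono part \<open>m\<close> is the kernel of the cokernel of \<open>f\<close>. The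
  work lies in showing that \<open>e\<close> is epi: if \<open>g\<close> kills \<open>e\<close>,
  then \<open>m\<close> already factors through its restriction to the kernel of \<open>g\<close>,
  so that kernel is everything and \<open>g\<close> is zero.\<close>

lemma epi_mono_factorization:
  assumes f: "f \<in> Hom C A B"
  obtains I e m where "e \<in> Hom C A I" "is_epi C e" "m \<in> Hom C I B" "is_mono C m" "f = m \<odot> e"
proof -
  obtain c where c0: "is_cokernel C f c" using ex_cokernel_Hom[OF f] by blast
  define Q where "Q = cod C c"
  note c = is_cokernelD(1-3)[OF c0 f, folded Q_def] and cu = is_cokernelD(4)[OF c0 f, folded Q_def]
  obtain m where m0: "is_kernel C c m" using ex_kernel_Hom[OF c(1)] by blast
  define I where "I = dom C m"
  note m = is_kernelD(1-3)[OF m0 c(1), folded I_def] and mu = is_kernelD(4)[OF m0 c(1), folded I_def]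
  obtain e where e: "e \<in> Hom C A I" "f = m \<odot> e" using mu[OF f c(3)] by blast
  have I: "I \<in> obj C" using Hom_obj[OF e(1)] by blast
  have "is_epi C e"
  proof (rule is_epiI_zero[OF e(1)])
    fix X g assume g: "g \<in> Hom C I X" "g \<odot> e = zero C A X"
    obtain k where k0: "is_kernel C g k" using ex_kernel_Hom[OF g(1)] by blast
    define K where "K = dom C k"
    note k = is_kernelD(1-3)[OF k0 g(1), folded K_def] and ku = is_kernelD(4)[OF k0 g(1), folded K_def]
    obtain e' where e': "e' \<in> Hom C A K" "e = k \<odot> e'" using ku[OF e(1) g(2)] by blast
    have mk: "m \<odot> k \<in> Hom C K B" using cmp_Hom k m by blast
    have f': "f = m \<odot> k \<odot> e'" using cmp_assoc[OF e'(1) k(1) m(1)] e(2) e'(2) by simp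
    \<comment> \<open>By normality \<open>m \<odot> k\<close> is itself the kernel of some
      \<open>h\<close>. This \<open>h\<close> kills \<open>f\<close>, hence factors through the
      cokernel \<open>c\<close>, and so kills \<open>m\<close> as well.\<close>
    obtain h where h: "is_kernel C h (m \<odot> k)"
      using mono_normal[OF is_mono_cmp[OF k(2) m(2) k(1) m(1)]] by blast
    define D where "D = cod C h"
    have hH: "h \<in> Hom C B D" using h HomD(3)[OF mk] by (simp add: is_kernel_def D_def Hom_def)
    note hk = is_kernelD[OF h hH, unfolded HomD(2)[OF mk]]
    have D: "D \<in> obj C" using Hom_obj[OF hH] by blast
    have "h \<odot> f = zero C A D"
      using f' cmp_assoc[OF e'(1) mk hH] hk(3) cmp_zero_left[OF e'(1) D] by simp
    then obtain h' where h': "h' \<in> Hom C Q D" "h = h' \<odot> c" using cu[OF hH] by blast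
    have "h \<odot> m = zero C I D"
      using h'(2) cmp_assoc[OF m(1) c(1) h'(1)] m(3) cmp_zero_right[OF h'(1) I] by simp
    then obtain w where w: "w \<in> Hom C I K" "m = m \<odot> k \<odot> w" using hk(4)[OF m(1)] by blast
    have "m \<odot> (k \<odot> w) = m \<odot> ident C I"
      using w cmp_assoc[OF w(1) k(1) m(1)] cmp_ident_right[OF m(1)] by simp
    then have "k \<odot> w = ident C I" using is_monoD[OF m(2,1) cmp_Hom[OF w(1) k(1)] ident_Hom[OF I]] by blast
    then have "g = g \<odot> (k \<odot> w)" using cmp_ident_right[OF g(1)] by simp
    also have "\<dots> = zero C I X"
      using cmp_assoc[OF w(1) k(1) g(1)] k(3) cmp_zero_left[OF w(1)] Hom_obj[OF g(1)] by simp
    finally show "g = zero C I X" .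
  qed
  then show thesis using that[OF e(1) _ m(1,2) e(2)] by simp
qed

section \<open>Zero objects detected by their identity arrow\<close>

lemma is_zero_objI:
  assumes X: "X \<in> obj C" and z: "ident C X = zero C X X"
  shows "is_zero_obj C X"
proof -
  have "f = zero C X A" if f: "f \<in> Hom C X A" for f A
    using cmp_ident_right[OF f] z cmp_zero_right[OF f X] by simp
  moreover have "f = zero C A X" if f: "f \<in> Hom C A X" for f A
    using cmp_ident_left[OF f] z cmp_zero_left[OF f X] by simp
  ultimately show ?thesis using X zero_Hom unfolding is_zero_obj_def by metis
qed

lemma is_zero_objD:
  assumes "is_zero_obj C X"
  shows "f \<in> Hom C X A \<Longrightarrow> f = zero C X A" "f \<in> Hom C A X \<Longrightarrow> f = zero C A X"
proof -
  show "f = zero C X A" if "f \<in> Hom C X A"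
    using assms that zero_Hom[of X A] Hom_obj[OF that] unfolding is_zero_obj_def by metis
  show "f = zero C A X" if "f \<in> Hom C A X"
    using assms that zero_Hom[of A X] Hom_obj[OF that] unfolding is_zero_obj_def by metis
qed

lemma is_zero_obj_dom_mono:
  assumes f: "is_mono C f" "f \<in> Hom C A B" and z: "f = zero C A B"
  shows "is_zero_obj C A"
proof (rule is_zero_objI)
  show A: "A \<in> obj C" using Hom_obj[OF f(2)] by blast
  have "f \<odot> ident C A = zero C A B" using cmp_ident_right[OF f(2)] z by simp
  then show "ident C A = zero C A A" using is_mono_zeroD[OF f ident_Hom[OF A]] by blast
qed

end

section \<open>Essential monomorphisms\<close>

text \<open>
  This form of essentiality mentions no subobjects, so it can be read in the opposite category,
  where it says that the kernel of the epimorphism \<open>a\<close> is superfluous.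
\<close>

definition essential_mono :: "('o, 'm) cat \<Rightarrow> 'm \<Rightarrow> bool" where
  "essential_mono C a \<longleftrightarrow> is_mono C a \<and>
     (\<forall>g \<in> arr C. dom C g = cod C a \<and> is_mono C (g \<odot>\<^bsub>C\<^esub> a) \<longrightarrow> is_mono C g)"

context abelian_category
begin

lemma essential_monoI:
  assumes "a \<in> Hom C A B" "is_mono C a"
    and "\<And>D g. g \<in> Hom C B D \<Longrightarrow> is_mono C (g \<odot> a) \<Longrightarrow> is_mono C g"
  shows "essential_mono C a"
  using assms HomD[OF assms(1)] arr_Hom[of _ C] unfolding essential_mono_def by metis

lemma essential_monoD:
  assumes "essential_mono C a" "a \<in> Hom C A B" "g \<in> Hom C B D" "is_mono C (g \<odot> a)"
  shows "is_mono C g"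
  using assms(1,4) HomD[OF assms(2)] HomD[OF assms(3)] unfolding essential_mono_def by metis

lemma essential_mono_is_mono: "essential_mono C a \<Longrightarrow> is_mono C a"
  by (simp add: essential_mono_def)

lemma essential_mono_cmp:
  assumes "essential_mono C a" "essential_mono C b" "a \<in> Hom C A B" "b \<in> Hom C B D"
  shows "essential_mono C (b \<odot> a)"
proof (rule essential_monoI[OF cmp_Hom[OF assms(3,4)]])
  show "is_mono C (b \<odot> a)" using is_mono_cmp essential_mono_is_mono assms by blast
next
  fix E g assume g: "g \<in> Hom C D E" "is_mono C (g \<odot> (b \<odot> a))"
  then have "is_mono C (g \<odot> b \<odot> a)" using cmp_assoc[OF assms(3,4) g(1)] by simp
  then have "is_mono C (g \<odot> b)" using essential_monoD[OF assms(1,3) cmp_Hom[OF assms(4) g(1)]] by blast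
  then show "is_mono C g" using essential_monoD[OF assms(2,4) g(1)] by blast
qed

text \<open>An arrow killed by \<open>c\<close> factors through \<open>m\<close>, so the last
  hypothesis applies to it. This replaces a pullback: if X meets A trivially in B, then X
  \<rightarrow> B/A is mono.\<close>

lemma is_mono_cokernel_cmpI:
  assumes m: "is_mono C m" "m \<in> Hom C A B" and c: "is_cokernel C m c" and f: "f \<in> Hom C X B"
    and z: "\<And>Y u v. u \<in> Hom C Y X \<Longrightarrow> v \<in> Hom C Y A \<Longrightarrow> f \<odot> u = m \<odot> v \<Longrightarrow> u = zero C Y X"
  shows "is_mono C (c \<odot> f)"
proof (rule is_monoI_zero)
  note cH = is_cokernelD(1)[OF c m(2)]
  show "c \<odot> f \<in> Hom C X (cod C c)" using cmp_Hom[OF f cH] .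
  fix Y u assume u: "u \<in> Hom C Y X" "c \<odot> f \<odot> u = zero C Y (cod C c)"
  have "c \<odot> (f \<odot> u) = zero C Y (cod C c)" using u cmp_assoc[OF u(1) f cH] by simp
  then obtain v where "v \<in> Hom C Y A" "f \<odot> u = m \<odot> v"
    using is_kernelD(4)[OF is_kernel_cokernel[OF m(1) c] cH cmp_Hom[OF u(1) f]] HomD(2)[OF m(2)]
    by auto
  then show "u = zero C Y X" using z[OF u(1)] by blast
qed

text \<open>\<open>k\<close> represents the preimage of E under \<open>f\<close>. If
  \<open>g\<close> is mono on that preimage, then \<open>f\<close> embeds the kernel of
  \<open>g\<close> into N so that it meets E trivially, and essentiality of \<open>e\<close> forces
  this kernel to vanish.\<close>

lemma essential_mono_preimage:
  assumes e: "essential_mono C e" "e \<in> Hom C E N" and f: "f \<in> Hom C M N"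
    and c: "is_cokernel C e c" and k: "is_kernel C (c \<odot> f) k"
  shows "essential_mono C k"
proof -
  note eM = essential_mono_is_mono[OF e(1)]
  note cH = is_cokernelD(1)[OF c e(2)]
  define Q where "Q = cod C c"
  have cfH: "c \<odot> f \<in> Hom C M Q" using cmp_Hom[OF f cH] Q_def by simp
  define K where "K = dom C k"
  note kD = is_kernelD[OF k cfH, folded K_def]
  show ?thesis
  proof (rule essential_monoI[OF kD(1,2)])
    fix D g assume g: "g \<in> Hom C M D" and gk: "is_mono C (g \<odot> k)"
    have gkH: "g \<odot> k \<in> Hom C K D" using cmp_Hom[OF kD(1) g] .
    show "is_mono C g"
    proof (rule is_monoI_zero[OF g])
      fix X x0 assume x0: "x0 \<in> Hom C X M" "g \<odot> x0 = zero C X D"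
      obtain x where x: "is_kernel C g x" using ex_kernel_Hom[OF g] by blast
      define Y where "Y = dom C x"
      note xD = is_kernelD[OF x g, folded Y_def]
      \<comment> \<open>Whatever part of the kernel of \<open>g\<close> is sent into E lies in the
        preimage \<open>k\<close>, where \<open>g\<close> is mono; as \<open>g\<close> kills it, it
        is zero.\<close>
      have *: "u = zero C Z Y" if u: "u \<in> Hom C Z Y" "c \<odot> (f \<odot> (x \<odot> u)) = zero C Z Q" for Z u
      proof -
        have xu: "x \<odot> u \<in> Hom C Z M" using cmp_Hom[OF u(1) xD(1)] .
        have "c \<odot> f \<odot> (x \<odot> u) = zero C Z Q" using cmp_assoc[OF xu f cH] u(2) by simp
        then obtain v where v: "v \<in> Hom C Z K" "x \<odot> u = k \<odot> v" using kD(4)[OF xu] by blast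
        have "g \<odot> k \<odot> v = g \<odot> x \<odot> u"
          using cmp_assoc[OF v(1) kD(1) g] cmp_assoc[OF u(1) xD(1) g] v(2) by simp
        also have "\<dots> = zero C Z D" using xD(3) cmp_zero_left[OF u(1)] Hom_obj[OF g] by simp
        finally have "v = zero C Z K" using is_mono_zeroD[OF gk gkH v(1)] by blast
        then have "x \<odot> u = zero C Z M" using v(2) cmp_zero_right[OF kD(1)] Hom_obj[OF v(1)] by simp
        then show ?thesis using is_mono_zeroD[OF xD(2,1) u(1)] by blast
      qed
      have fx: "f \<odot> x \<in> Hom C Y N" using cmp_Hom[OF xD(1) f] .
      have fxM: "is_mono C (f \<odot> x)"
      proof (rule is_monoI_zero[OF fx])
        fix Z u assume u: "u \<in> Hom C Z Y" "f \<odot> x \<odot> u = zero C Z N"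
        have "f \<odot> (x \<odot> u) = zero C Z N" using cmp_assoc[OF u(1) xD(1) f] u(2) by simp
        then have "c \<odot> (f \<odot> (x \<odot> u)) = zero C Z Q"
          using cmp_zero_right[OF cH] Hom_obj[OF u(1)] Q_def by simp
        then show "u = zero C Z Y" using * u by blast
      qed
      obtain c' where c': "is_cokernel C (f \<odot> x) c'" using ex_cokernel_Hom[OF fx] by blast
      define Q' where "Q' = cod C c'"
      note cD' = is_cokernelD[OF c' fx, folded Q'_def]
      \<comment> \<open>E meets the image of \<open>f \<odot> x\<close> trivially, so it embeds into
        the quotient by that image. Essentiality then makes N itself embed there, which leaves only
        zero for \<open>f \<odot> x\<close>.\<close>
      have "is_mono C (c' \<odot> e)"
      proof (rule is_mono_cokernel_cmpI[OF fxM fx c' e(2)])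
        fix Z y u assume y: "y \<in> Hom C Z E" and u: "u \<in> Hom C Z Y" and eq: "e \<odot> y = f \<odot> x \<odot> u"
        have Z: "Z \<in> obj C" using Hom_obj[OF u] by blast
        have "c \<odot> (f \<odot> (x \<odot> u)) = c \<odot> e \<odot> y"
          using cmp_assoc[OF u xD(1) f] cmp_assoc[OF y e(2) cH] eq by simp
        also have "\<dots> = zero C Z Q"
          using is_cokernelD(3)[OF c e(2)] cmp_zero_left[OF y] Hom_obj[OF cH] Q_def by simp
        finally have "u = zero C Z Y" using * u by blast
        then have "e \<odot> y = zero C Z N" using eq cmp_zero_right[OF fx Z] by simp
        then show "y = zero C Z E" using is_mono_zeroD[OF eM e(2) y] by blast
      qed
      then have cM': "is_mono C c'" using essential_monoD[OF e cD'(1)] by blast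
      have "f \<odot> x = zero C Y N" using is_mono_zeroD[OF cM' cD'(1) fx cD'(3)] .
      then have "is_zero_obj C Y" using is_zero_obj_dom_mono[OF fxM fx] by blast
      moreover obtain w where w: "w \<in> Hom C X Y" "x0 = x \<odot> w" using xD(4)[OF x0] by blast
      ultimately have "w = zero C X Y" using is_zero_objD by blast
      then show "x0 = zero C X M" using w cmp_zero_right[OF xD(1)] Hom_obj[OF w(1)] by simp
    qed
  qed
qed

section \<open>Subobjects, intersections and sums\<close>

lemma subobjectD:
  assumes "subobject C M k"
  shows "is_mono C k" "k \<in> Hom C (dom C k) M"
  using assms by (auto simp: subobject_def is_mono_def Hom_def)

lemma subobjectI: "is_mono C k \<Longrightarrow> k \<in> Hom C K M \<Longrightarrow> subobject C M k"
  by (auto simp: subobject_def Hom_def)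

lemma sub_leI:
  assumes "a \<in> Hom C K L" "l \<in> Hom C L M" "k = l \<odot> a"
  shows "sub_le C k l"
  using assms HomD[OF assms(2)] HomD[OF cmp_Hom[OF assms(1,2)]] unfolding sub_le_def by auto

lemma sub_leD:
  assumes "sub_le C k l" "k \<in> Hom C K M" "l \<in> Hom C L M"
  shows "\<exists>a \<in> Hom C K L. k = l \<odot> a"
  using assms HomD(2) unfolding sub_le_def by metis

lemma sub_le_trans:
  assumes "sub_le C j k" "sub_le C k l" "j \<in> Hom C J M" "k \<in> Hom C K M" "l \<in> Hom C L M"
  shows "sub_le C j l"
proof -
  obtain a where a: "a \<in> Hom C J K" "j = k \<odot> a" using sub_leD[OF assms(1,3,4)] by blast
  obtain b where b: "b \<in> Hom C K L" "k = l \<odot> b" using sub_leD[OF assms(2,4,5)] by blast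
  have "j = l \<odot> (b \<odot> a)" using a b cmp_assoc[OF a(1) b(1) assms(5)] by simp
  then show ?thesis using sub_leI[OF cmp_Hom[OF a(1) b(1)] assms(5)] by blast
qed

text \<open>Containment becomes an equation between arrows. Every subobject is the kernel of its
  cokernel, so this is the usual way in which containments are checked.\<close>

lemma sub_le_kernel_iff:
  assumes f: "f \<in> Hom C M N" "is_kernel C f l" and k: "k \<in> Hom C K M"
  shows "sub_le C k l \<longleftrightarrow> f \<odot> k = zero C K N"
proof
  define L where "L = dom C l"
  note lD = is_kernelD[OF f(2,1), folded L_def]
  show "sub_le C k l" if "f \<odot> k = zero C K N" using lD(4)[OF k that] sub_leI[OF _ lD(1)] by blast
  assume "sub_le C k l"
  then obtain a where a: "a \<in> Hom C K L" "k = l \<odot> a" using sub_leD k lD(1) by blast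
  then show "f \<odot> k = zero C K N"
    using cmp_assoc[OF a(1) lD(1) f(1)] lD(3) cmp_zero_left[OF a(1)] Hom_obj[OF f(1)] by simp
qed

lemma sub_le_cokernel_iff:
  assumes l: "subobject C M l" "is_cokernel C l c" and k: "k \<in> Hom C K M"
  shows "sub_le C k l \<longleftrightarrow> c \<odot> k = zero C K (cod C c)"
  using sub_le_kernel_iff[OF is_cokernelD(1)[OF l(2) subobjectD(2)[OF l(1)]]
      is_kernel_cokernel[OF subobjectD(1)[OF l(1)] l(2)] k] .

text \<open>\<open>d\<close> factors through \<open>c\<close> iff it kills \<open>k\<close>, that
  is, iff K is contained in the kernel \<open>l\<close> of \<open>d\<close>.\<close>

lemma sub_le_opcat_cokernels:
  assumes k: "subobject C M k" "is_cokernel C k c" and l: "subobject C M l" "is_cokernel C l d"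
  shows "sub_le (opcat C) d c \<longleftrightarrow> sub_le C k l"
proof -
  interpret op: abelian_category "opcat C" by (rule abelian_category_op)
  have kH: "k \<in> Hom C (dom C k) M" using subobjectD(2) k by blast
  have dH: "d \<in> Hom C M (cod C d)" using is_cokernelD(1) subobjectD(2) l by blast
  show ?thesis
    using op.sub_le_kernel_iff[of k M "dom C k" c d "cod C d"] sub_le_cokernel_iff[OF l kH] kH k(2) dH
    by simp
qed

lemma subobject_opcat: "subobject (opcat C) M c \<longleftrightarrow> is_epi C c \<and> dom C c = M"
  by (simp add: subobject_def)

text \<open>Cokernels match the subobjects of M with its quotients, which are its subobjects in the
  opposite category, and they reverse the order. Least upper bounds thus become greatest lower
  bounds.\<close>

lemma is_sum_iff_intersection_opcat:
  assumes s: "\<And>i. i \<in> I \<Longrightarrow> subobject C M (s i) \<and> is_cokernel C (s i) (c i)"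
    and l: "subobject C M l" "is_cokernel C l d"
  shows "is_sum C M (s ` I) l \<longleftrightarrow> is_intersection (opcat C) M (c ` I) d"
proof -
  note lH = subobjectD(2)[OF l(1)]
  have d: "subobject (opcat C) M d"
    using is_cokernelD(1,2)[OF l(2) lH] HomD(2) by (fastforce simp: subobject_opcat)
  have le: "sub_le (opcat C) d' (c i) \<longleftrightarrow> sub_le C (s i) l'"
    if "i \<in> I" "subobject C M l'" "is_cokernel C l' d'" for i l' d'
    using sub_le_opcat_cokernels s that by blast
  have coker: "\<exists>d'. is_cokernel C l' d' \<and> subobject (opcat C) M d'" if "subobject C M l'" for l'
  proof -
    note lH' = subobjectD(2)[OF that]
    obtain d' where d': "is_cokernel C l' d'" using ex_cokernel_Hom[OF lH'] by blast
    then show ?thesis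
      using is_cokernelD(1,2)[OF d' lH'] HomD(2) by (fastforce simp: subobject_opcat)
  qed
  \<comment> \<open>Every competing quotient arises from a subobject, because an epimorphism is the
    cokernel of its kernel.\<close>
  have ker: "\<exists>l'. is_cokernel C l' d' \<and> subobject C M l'" if "subobject (opcat C) M d'" for d'
  proof -
    have e: "is_epi C d'" "d' \<in> Hom C M (cod C d')"
      using that by (auto simp: subobject_opcat is_epi_def Hom_def)
    obtain l' where l': "is_kernel C d' l'" using ex_kernel_Hom[OF e(2)] by blast
    then show ?thesis
      using is_cokernel_kernel[OF e(1) l'] is_kernelD(1,2)[OF l' e(2)] subobjectI by blast
  qed
  show ?thesis
  proof
    assume sum: "is_sum C M (s ` I) l"
    show "is_intersection (opcat C) M (c ` I) d"
      unfolding is_intersection_def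
    proof (intro conjI allI impI d ballI)
      fix x assume "x \<in> c ` I"
      then show "sub_le (opcat C) d x" using sum le[OF _ l] unfolding is_sum_def by auto
    next
      fix d' assume d': "subobject (opcat C) M d' \<and> (\<forall>x \<in> c ` I. sub_le (opcat C) d' x)"
      then obtain l' where l': "is_cokernel C l' d'" "subobject C M l'" using ker by blast
      then have "\<forall>x \<in> s ` I. sub_le C x l'" using d' le by auto
      then have "sub_le C l l'" using sum l' unfolding is_sum_def by blast
      then show "sub_le (opcat C) d' d" using sub_le_opcat_cokernels l l' by blast
    qed
  next
    assume int: "is_intersection (opcat C) M (c ` I) d"
    show "is_sum C M (s ` I) l"
      unfolding is_sum_def
    proof (intro conjI allI impI l(1) ballI)
      fix x assume "x \<in> s ` I"
      then show "sub_le C x l" using int le[OF _ l] unfolding is_intersection_def by auto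
    next
      fix l' assume l': "subobject C M l' \<and> (\<forall>x \<in> s ` I. sub_le C x l')"
      then obtain d' where d': "is_cokernel C l' d'" "subobject (opcat C) M d'" using coker by blast
      then have "\<forall>x \<in> c ` I. sub_le (opcat C) d' x" using l' le by auto
      then have "sub_le (opcat C) d' d" using int d' unfolding is_intersection_def by blast
      then show "sub_le C l l'" using sub_le_opcat_cokernels l l' d' by blast
    qed
  qed
qed

text \<open>The intersection is the kernel of the arrow from M to the product of the quotients
  M/S_i. Smallness of the index set is what makes this product available.\<close>

lemma ex_intersection:
  assumes "AB3_star C U" "small U I" and M: "M \<in> obj C" and s: "\<And>i. i \<in> I \<Longrightarrow> subobject C M (s i)"
  shows "\<exists>k. is_intersection C M (s ` I) k"
proof -
  have "\<forall>i \<in> I. \<exists>c. is_cokernel C (s i) c" using s subobjectD(2) ex_cokernel_Hom by blast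
  then obtain c where c: "\<And>i. i \<in> I \<Longrightarrow> is_cokernel C (s i) (c i)" using bchoice[of I] by metis
  have cH: "c i \<in> Hom C M (cod C (c i))" if "i \<in> I" for i
    using is_cokernelD(1)[OF c] s subobjectD(2) that by blast
  obtain P p where P: "is_product C I (\<lambda>i. cod C (c i)) P p"
    using assms(1,2) cH Hom_obj unfolding AB3_star_def by metis
  then have PO: "P \<in> obj C" and p: "\<And>i. i \<in> I \<Longrightarrow> p i \<in> Hom C P (cod C (c i))"
    by (auto simp: is_product_def)
  have "\<exists>!h. h \<in> Hom C M P \<and> (\<forall>i \<in> I. p i \<odot> h = c i)"
    using P M cH unfolding is_product_def by simp
  then obtain h where h: "h \<in> Hom C M P" "\<And>i. i \<in> I \<Longrightarrow> p i \<odot> h = c i" by blast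
  obtain k where k: "is_kernel C h k" using ex_kernel_Hom[OF h(1)] by blast
  note kD = is_kernelD[OF k h(1)]
  have "sub_le C l k" if l: "subobject C M l" "\<forall>x \<in> s ` I. sub_le C l x" for l
  proof -
    define L where "L = dom C l"
    have lH: "l \<in> Hom C L M" using subobjectD(2) l L_def by blast
    have L: "L \<in> obj C" using Hom_obj[OF lH] by blast
    have hl: "h \<odot> l \<in> Hom C L P" using cmp_Hom[OF lH h(1)] .
    \<comment> \<open>\<open>h \<odot> l\<close> and the zero arrow have the same components, so the
      universal property of the product identifies them.\<close>
    have "p i \<odot> (h \<odot> l) = zero C L (cod C (c i)) \<and> p i \<odot> zero C L P = zero C L (cod C (c i))"
      if i: "i \<in> I" for i
      using sub_le_cokernel_iff[OF s[OF i] c[OF i] lH] l(2) i cmp_assoc[OF lH h(1) p[OF i]] h(2)[OF i]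
        cmp_zero_right[OF p[OF i] L] by simp
    moreover have "\<exists>!u. u \<in> Hom C L P \<and> (\<forall>i \<in> I. p i \<odot> u = zero C L (cod C (c i)))"
    proof -
      have "\<forall>i \<in> I. zero C L (cod C (c i)) \<in> Hom C L (cod C (c i))"
        using zero_Hom[OF L] Hom_obj(2)[OF cH] by blast
      then show ?thesis using P L unfolding is_product_def by simp
    qed
    ultimately have "h \<odot> l = zero C L P" using hl zero_Hom[OF L PO] by metis
    then show ?thesis using sub_le_kernel_iff[OF h(1) k lH] by simp
  qed
  moreover have "sub_le C k (s i)" if i: "i \<in> I" for i
  proof -
    have "c i \<odot> k = p i \<odot> (h \<odot> k)" using cmp_assoc[OF kD(1) h(1) p[OF i]] h(2)[OF i] by simp
    also have "\<dots> = zero C (dom C k) (cod C (c i))"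
      using kD(3) cmp_zero_right[OF p[OF i]] Hom_obj[OF kD(1)] by simp
    finally show ?thesis using sub_le_cokernel_iff[OF s[OF i] c[OF i] kD(1)] by simp
  qed
  ultimately have "is_intersection C M (s ` I) k"
    unfolding is_intersection_def using subobjectI[OF kD(2,1)] by blast
  then show ?thesis by blast
qed

section \<open>Essential and superfluous subobjects\<close>

text \<open>A subobject \<open>x\<close> is traded for an arrow \<open>g\<close> with kernel
  \<open>x\<close>. Then the kernel of \<open>g \<odot> a\<close> is the intersection of
  \<open>a\<close> and \<open>x\<close>, so that \<open>g \<odot> a\<close> is mono iff this
  intersection is zero, and \<open>g\<close> is mono iff \<open>x\<close> is zero. One direction
  takes the kernel of a given \<open>g\<close>, the other the cokernel of a given
  \<open>x\<close>.\<close>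

lemma essential_iff: "essential C B a \<longleftrightarrow> subobject C B a \<and> essential_mono C a"
proof (cases "subobject C B a")
  case True
  define A where "A = dom C a"
  note a = subobjectD[OF True, folded A_def]
  have B: "B \<in> obj C" using Hom_obj[OF a(2)] by blast
  have "essential_mono C a" if ess: "essential C B a"
  proof (rule essential_monoI[OF a(2,1)])
    fix D g assume g: "g \<in> Hom C B D" "is_mono C (g \<odot> a)"
    obtain x where x0: "is_kernel C g x" using ex_kernel_Hom[OF g(1)] by blast
    define X where "X = dom C x"
    note x = is_kernelD[OF x0 g(1), folded X_def]
    obtain Z where Z: "is_zero_obj C Z" using ex_zero_obj by blast
    then have ZO: "Z \<in> obj C" by (simp add: is_zero_obj_def)
    \<comment> \<open>The zero subobject is represented by the zero arrow from a zero object. A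
      concrete representative is required, since \<open>essential\<close> quantifies over an
      existing intersection.\<close>
    have zH: "zero C Z B \<in> Hom C Z B" using zero_Hom ZO B by blast
    have zM: "is_mono C (zero C Z B)"
    proof (rule is_monoI_zero[OF zH])
      fix Y u assume "u \<in> Hom C Y Z"
      then show "u = zero C Y Z" using is_zero_objD(2)[OF Z] by blast
    qed
    have z_le: "sub_le C (zero C Z B) l" if l: "l \<in> Hom C L B" for l L
    proof (rule sub_leI[OF _ l])
      show "zero C Z L \<in> Hom C Z L" using zero_Hom ZO Hom_obj[OF l] by blast
      show "zero C Z B = l \<odot> zero C Z L" using cmp_zero_right[OF l ZO] by simp
    qed
    have "is_intersection C B {a, x} (zero C Z B)"
      unfolding is_intersection_def
    proof (intro conjI allI impI subobjectI[OF zM zH] ballI)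
      fix s assume "s \<in> {a, x}"
      then show "sub_le C (zero C Z B) s" using z_le a(2) x(1) by blast
    next
      fix l assume l: "subobject C B l \<and> (\<forall>s \<in> {a, x}. sub_le C l s)"
      define L where "L = dom C l"
      have lH: "l \<in> Hom C L B" using subobjectD(2) l L_def by blast
      have L: "L \<in> obj C" using Hom_obj[OF lH] by blast
      obtain u where u: "u \<in> Hom C L A" "l = a \<odot> u" using sub_leD[OF _ lH a(2)] l by blast
      have "g \<odot> l = zero C L D" using sub_le_kernel_iff[OF g(1) x0 lH] l by blast
      then have "g \<odot> a \<odot> u = zero C L D" using cmp_assoc[OF u(1) a(2) g(1)] u(2) by simp
      then have "u = zero C L A" using is_mono_zeroD[OF g(2) cmp_Hom[OF a(2) g(1)] u(1)] by blast
      then have l0: "l = zero C L B" using u(2) cmp_zero_right[OF a(2) L] by simp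
      show "sub_le C l (zero C Z B)"
      proof (rule sub_leI[OF _ zH])
        show "zero C L Z \<in> Hom C L Z" using zero_Hom ZO L by blast
        show "l = zero C Z B \<odot> zero C L Z" using cmp_zero_right[OF zH L] l0 by simp
      qed
    qed
    moreover have "is_zero_obj C (dom C (zero C Z B))" using Z HomD(2)[OF zH] by simp
    ultimately have "is_zero_obj C X"
      using ess subobjectI[OF x(2,1)] X_def unfolding essential_def by blast
    then have X0: "h = zero C Y X" if "h \<in> Hom C Y X" for h Y using is_zero_objD(2) that by blast
    show "is_mono C g"
    proof (rule is_monoI_zero[OF g(1)])
      fix Y y assume y: "y \<in> Hom C Y B" "g \<odot> y = zero C Y D"
      obtain h where "h \<in> Hom C Y X" "y = x \<odot> h" using x(4)[OF y] by blast
      then show "y = zero C Y B" using X0 cmp_zero_right[OF x(1)] Hom_obj[OF y(1)] by metis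
    qed
  qed
  moreover have "essential C B a" if ess: "essential_mono C a"
  proof -
    have "is_zero_obj C (dom C x)"
      if sx: "subobject C B x" and z: "is_intersection C B {a, x} z" "is_zero_obj C (dom C z)" for x z
    proof -
      define X where "X = dom C x"
      note x = subobjectD[OF sx, folded X_def]
      obtain g where g0: "is_cokernel C x g" using ex_cokernel_Hom[OF x(2)] by blast
      define D where "D = cod C g"
      note g = is_cokernelD[OF g0 x(2), folded D_def]
      have ga: "g \<odot> a \<in> Hom C A D" using cmp_Hom[OF a(2) g(1)] .
      obtain k where k0: "is_kernel C (g \<odot> a) k" using ex_kernel_Hom[OF ga] by blast
      define K where "K = dom C k"
      note k = is_kernelD[OF k0 ga, folded K_def]
      have akH: "a \<odot> k \<in> Hom C K B" using cmp_Hom[OF k(1) a(2)] .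
      have K: "K \<in> obj C" using Hom_obj[OF k(1)] by blast
      \<comment> \<open>\<open>a \<odot> k\<close> represents the intersection of \<open>a\<close>
        and \<open>x\<close>, so it lies below the given zero intersection \<open>z\<close> and
        vanishes.\<close>
      have "sub_le C (a \<odot> k) x"
        using sub_le_cokernel_iff[OF sx g0 akH] cmp_assoc[OF k(1) a(2) g(1)] k(3) D_def by simp
      moreover have "sub_le C (a \<odot> k) a" using sub_leI[OF k(1) a(2)] by blast
      moreover have "subobject C B (a \<odot> k)"
        using subobjectI[OF _ akH] is_mono_cmp[OF k(2) a(1) k(1) a(2)] by blast
      ultimately have "sub_le C (a \<odot> k) z" using z(1) unfolding is_intersection_def by blast
      moreover have zH: "z \<in> Hom C (dom C z) B"
        using z(1) subobjectD(2) unfolding is_intersection_def by blast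
      ultimately obtain w where w: "w \<in> Hom C K (dom C z)" "a \<odot> k = z \<odot> w"
        using sub_leD[OF _ akH] by blast
      have "a \<odot> k = zero C K B"
        using w is_zero_objD(2)[OF z(2) w(1)] cmp_zero_right[OF zH K] by simp
      then have k_zero: "k = zero C K A" using is_mono_zeroD[OF a k(1)] by blast
      have "is_mono C (g \<odot> a)"
      proof (rule is_monoI_zero[OF ga])
        fix Y u assume u: "u \<in> Hom C Y A" "g \<odot> a \<odot> u = zero C Y D"
        obtain h where "h \<in> Hom C Y K" "u = k \<odot> h" using k(4)[OF u] by blast
        then show "u = zero C Y A" using k_zero cmp_zero_left Hom_obj[OF a(2)] by metis
      qed
      then have gM: "is_mono C g" using essential_monoD[OF ess a(2) g(1)] by blast
      have "x = zero C X B" using is_mono_zeroD[OF gM g(1) x(2) g(3)] .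
      then show ?thesis using is_zero_obj_dom_mono[OF x] X_def by simp
    qed
    then show ?thesis using True unfolding essential_def by blast
  qed
  ultimately show ?thesis using True by blast
qed (simp add: essential_def)

lemma essential_mono_opcatI:
  assumes "p \<in> Hom C A B" "is_epi C p"
    and "\<And>D g. g \<in> Hom C D A \<Longrightarrow> is_epi C (p \<odot> g) \<Longrightarrow> is_epi C g"
  shows "essential_mono (opcat C) p"
proof -
  interpret op: abelian_category "opcat C" by (rule abelian_category_op)
  show ?thesis using op.essential_monoI[of p B A] assms by simp
qed

lemma essential_mono_opcatD:
  assumes "essential_mono (opcat C) p" "p \<in> Hom C A B" "g \<in> Hom C D A" "is_epi C (p \<odot> g)"
  shows "is_epi C g"
proof -
  interpret op: abelian_category "opcat C" by (rule abelian_category_op)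
  show ?thesis using op.essential_monoD[of p B A g D] assms by simp
qed

text \<open>A + X = B means that X \<rightarrow> B/A is epi, so superfluity of A says that any such
  X is already all of B. An arbitrary arrow \<open>g\<close> is reduced to a subobject through its
  image.\<close>

lemma superfluous_iff:
  assumes sa: "subobject C B a" and p0: "is_cokernel C a p"
  shows "superfluous C B a \<longleftrightarrow> essential_mono (opcat C) p"
proof
  define A Q where "A = dom C a" and "Q = cod C p"
  note a = subobjectD[OF sa, folded A_def]
  note p = is_cokernelD[OF p0 a(2), folded Q_def]
  have B: "B \<in> obj C" using Hom_obj[OF a(2)] by blast
  show "essential_mono (opcat C) p" if sup: "superfluous C B a"
  proof (rule essential_mono_opcatI[OF p(1,2)])
    fix D g assume g: "g \<in> Hom C D B" "is_epi C (p \<odot> g)"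
    obtain c where c0: "is_cokernel C g c" using ex_cokernel_Hom[OF g(1)] by blast
    define R where "R = cod C c"
    note c = is_cokernelD[OF c0 g(1), folded R_def]
    \<comment> \<open>The kernel of the cokernel of \<open>g\<close>, that is, its image.\<close>
    obtain x where x0: "is_kernel C c x" using ex_kernel_Hom[OF c(1)] by blast
    define X where "X = dom C x"
    note x = is_kernelD[OF x0 c(1), folded X_def]
    have id: "ident C B \<in> Hom C B B" using ident_Hom[OF B] .
    have id_iso: "is_iso C (ident C B)"
      using HomD[OF id] id cmp_ident_left[OF id] unfolding is_iso_def by auto
    have le_id: "sub_le C l (ident C B)" if "l \<in> Hom C L B" for l L
      using sub_leI[OF that id] cmp_ident_left[OF that] by simp
    have "is_sum C B {a, x} (ident C B)"
      unfolding is_sum_def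
    proof (intro conjI allI impI ballI subobjectI[OF is_iso_is_mono[OF id_iso] id])
      fix s assume "s \<in> {a, x}"
      then show "sub_le C s (ident C B)" using le_id a(2) x(1) by blast
    next
      \<comment> \<open>The cokernel \<open>e\<close> of an upper bound kills A and X, so it factors
        as \<open>h \<odot> p\<close> with \<open>h\<close> killing the epimorphism
        \<open>p \<odot> g\<close>. Hence \<open>e\<close> is zero and the upper bound is all of
        B.\<close>
      fix l assume l: "subobject C B l \<and> (\<forall>s \<in> {a, x}. sub_le C s l)"
      then have lH: "l \<in> Hom C (dom C l) B" using subobjectD(2) by blast
      obtain e where e0: "is_cokernel C l e" using ex_cokernel_Hom[OF lH] by blast
      define E where "E = cod C e"
      note e = is_cokernelD[OF e0 lH, folded E_def]
      have E: "E \<in> obj C" using Hom_obj[OF e(1)] by blast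
      have ea: "e \<odot> a = zero C A E" and ex: "e \<odot> x = zero C X E"
        using sub_le_cokernel_iff[OF _ e0] l a(2) x(1) E_def by blast+
      obtain h where h: "h \<in> Hom C Q E" "e = h \<odot> p" using p(4)[OF e(1) ea] by blast
      obtain g' where g': "g' \<in> Hom C D X" "g = x \<odot> g'" using x(4)[OF g(1) c(3)] by blast
      have "e \<odot> g = e \<odot> x \<odot> g'" using g' cmp_assoc[OF g'(1) x(1) e(1)] by simp
      then have "e \<odot> g = zero C D E" using ex cmp_zero_left[OF g'(1) E] by simp
      then have "h \<odot> (p \<odot> g) = zero C D E" using h cmp_assoc[OF g(1) p(1) h(1)] by simp
      then have "h = zero C Q E" using is_epi_zeroD[OF g(2) cmp_Hom[OF g(1) p(1)] h(1)] by blast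
      then have "e = zero C B E" using h cmp_zero_left[OF p(1) E] by simp
      then have "e \<odot> ident C B = zero C B E" using cmp_ident_right[OF e(1)] by simp
      then show "sub_le C (ident C B) l" using sub_le_cokernel_iff[OF _ e0 id] l E_def by simp
    qed
    then have "is_iso C x"
      using sup id_iso subobjectI[OF x(2,1)] unfolding superfluous_def by blast
    then have c_zero: "c = zero C B R" using is_epi_zeroD[OF is_iso_is_epi x(1) c(1) x(3)] by blast
    show "is_epi C g"
    proof (rule is_epiI_zero[OF g(1)])
      fix Y u assume u: "u \<in> Hom C B Y" "u \<odot> g = zero C D Y"
      obtain h where "h \<in> Hom C R Y" "u = h \<odot> c" using c(4)[OF u] by blast
      then show "u = zero C B Y" using c_zero cmp_zero_right B by metis
    qed
  qed
  show "superfluous C B a" if ess: "essential_mono (opcat C) p"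
  proof -
    have "is_iso C x" if sx: "subobject C B x" and s: "is_sum C B {a, x} s" "is_iso C s" for x s
    proof -
      define X where "X = dom C x"
      note x = subobjectD[OF sx, folded X_def]
      have px: "p \<odot> x \<in> Hom C X Q" using cmp_Hom[OF x(2) p(1)] .
      have sH: "s \<in> Hom C (dom C s) B" using s(1) subobjectD(2) unfolding is_sum_def by blast
      have "is_epi C (p \<odot> x)"
      proof (rule is_epiI_zero[OF px])
        fix Y h assume h: "h \<in> Hom C Q Y" "h \<odot> (p \<odot> x) = zero C X Y"
        have hp: "h \<odot> p \<in> Hom C B Y" using cmp_Hom[OF p(1) h(1)] .
        have Y: "Y \<in> obj C" using Hom_obj[OF hp] by blast
        \<comment> \<open>The kernel of \<open>h \<odot> p\<close> contains both A and X, hence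
          their sum, which is all of B.\<close>
        obtain l where l0: "is_kernel C (h \<odot> p) l" using ex_kernel_Hom[OF hp] by blast
        have "sub_le C x l" using sub_le_kernel_iff[OF hp l0 x(2)] h(2) cmp_assoc[OF x(2) p(1) h(1)] by simp
        moreover have "sub_le C a l"
          using sub_le_kernel_iff[OF hp l0 a(2)] cmp_assoc[OF a(2) p(1) h(1)] p(3)
            cmp_zero_right[OF h(1)] Hom_obj[OF a(2)] by simp
        moreover have "subobject C B l" using subobjectI is_kernelD(1,2)[OF l0 hp] by blast
        ultimately have "sub_le C s l" using s(1) unfolding is_sum_def by blast
        then have "h \<odot> p \<odot> s = zero C (dom C s) Y" using sub_le_kernel_iff[OF hp l0 sH] by simp
        then have "h \<odot> p = zero C B Y" using is_epi_zeroD[OF is_iso_is_epi[OF s(2)] sH hp] by blast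
        then show "h = zero C Q Y" using is_epi_zeroD[OF p(2,1) h(1)] by blast
      qed
      then have "is_epi C x" using essential_mono_opcatD[OF ess p(1) x(2)] by blast
      then show ?thesis using is_isoI x(1) by blast
    qed
    then show ?thesis using sa unfolding superfluous_def by blast
  qed
qed

lemma lies_above_iff:
  assumes sl: "subobject C M l" and sk: "subobject C M k"
    and p0: "is_cokernel C k p" and c0: "is_cokernel C l c"
  shows "lies_above C M l k \<longleftrightarrow>
    (\<exists>t \<in> Hom C (cod C p) (cod C c). c = t \<odot> p \<and> essential_mono (opcat C) t)"
proof
  define K L P Q where "K = dom C k" and "L = dom C l" and "P = cod C p" and "Q = cod C c"
  note k = subobjectD[OF sk, folded K_def]
  note l = subobjectD[OF sl, folded L_def]
  note p = is_cokernelD[OF p0 k(2), folded P_def]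
  note c = is_cokernelD[OF c0 l(2), folded Q_def]
  have Q: "Q \<in> obj C" using Hom_obj[OF c(1)] by blast
  show "\<exists>t \<in> Hom C (cod C p) (cod C c). c = t \<odot> p \<and> essential_mono (opcat C) t"
    if la: "lies_above C M l k"
  proof -
    obtain a p' q b where a: "a \<in> Hom C K L" "k = l \<odot> a" and p0': "is_cokernel C k p'"
      and q0: "is_cokernel C a q" and bH0: "b \<in> Hom C (cod C q) (cod C p')" and bq: "b \<odot> q = p' \<odot> l"
      and sup: "superfluous C (cod C p') b"
      using la[unfolded lies_above_def, folded K_def L_def] by blast
    define P' R where "P' = cod C p'" and "R = cod C q"
    note p' = is_cokernelD[OF p0' k(2), folded P'_def]
    note q = is_cokernelD[OF q0 a(1), folded R_def]
    note b = bH0[folded P'_def R_def]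
    have sb: "subobject C P' b" using sup unfolding superfluous_def P'_def by blast
    obtain u where u0: "is_cokernel C b u" using ex_cokernel_Hom[OF b] by blast
    define V where "V = cod C u"
    note u = is_cokernelD[OF u0 b, folded V_def]
    have V: "V \<in> obj C" using Hom_obj[OF u(1)] by blast
    have essu: "essential_mono (opcat C) u" using superfluous_iff[OF sb u0] sup P'_def by simp
    \<comment> \<open>The cokernel \<open>p'\<close> provided by \<open>lies_above\<close> need not
      be the given \<open>p\<close>; \<open>\<phi>\<close> and \<open>\<psi>\<close> compare the
      two.\<close>
    obtain \<phi> where \<phi>: "\<phi> \<in> Hom C P P'" "p' = \<phi> \<odot> p" using p(4)[OF p'(1,3)] by blast
    obtain \<psi> where \<psi>: "\<psi> \<in> Hom C P' P" "p = \<psi> \<odot> p'" using p'(4)[OF p(1,3)] by blast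
    have PO: "P \<in> obj C" using Hom_obj[OF p(1)] by blast
    have "\<psi> \<odot> \<phi> \<odot> p = ident C P \<odot> p"
      unfolding cmp_assoc[OF p(1) \<phi>(1) \<psi>(1)] cmp_ident_left[OF p(1)]
      using \<phi>(2) \<psi>(2) by metis
    then have \<psi>\<phi>: "\<psi> \<odot> \<phi> = ident C P"
      using is_epiD[OF p(2,1) cmp_Hom[OF \<phi>(1) \<psi>(1)] ident_Hom[OF PO]] by blast
    have \<psi>e: "is_epi C \<psi>" using is_epi_cmpD[OF _ p'(1) \<psi>(1)] p(2) \<psi>(2) by simp
    have "c \<odot> k = zero C K Q"
      using a cmp_assoc[OF a(1) l(2) c(1)] c(3) cmp_zero_left[OF a(1) Q] by simp
    then obtain t where t: "t \<in> Hom C P Q" "c = t \<odot> p" using p(4)[OF c(1)] by blast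
    \<comment> \<open>On L the projection \<open>p'\<close> passes through \<open>b\<close>, which
      \<open>u\<close> kills. The resulting epimorphism \<open>\<chi>\<close> out of M/L carries
      epimorphisms \<open>t \<odot> g\<close> over to \<open>u\<close>, where superfluity is
      known.\<close>
    have "u \<odot> p' \<odot> l = u \<odot> b \<odot> q"
      using cmp_assoc[OF l(2) p'(1) u(1)] cmp_assoc[OF q(1) b u(1)] bq by simp
    also have "\<dots> = zero C L V" using u(3) cmp_zero_left[OF q(1) V] by simp
    finally obtain \<chi> where \<chi>: "\<chi> \<in> Hom C Q V" "u \<odot> p' = \<chi> \<odot> c"
      using c(4)[OF cmp_Hom[OF p'(1) u(1)]] by blast
    have "is_epi C (\<chi> \<odot> c)" using is_epi_cmp[OF p'(2) u(2) p'(1) u(1)] \<chi>(2) by simp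
    then have \<chi>e: "is_epi C \<chi>" using is_epi_cmpD[OF _ c(1) \<chi>(1)] by blast
    have "u \<odot> \<phi> \<odot> p = \<chi> \<odot> t \<odot> p"
      using cmp_assoc[OF p(1) \<phi>(1) u(1)] cmp_assoc[OF p(1) t(1) \<chi>(1)] \<phi>(2) t(2) \<chi>(2) by simp
    then have u\<phi>: "u \<odot> \<phi> = \<chi> \<odot> t"
      using is_epiD[OF p(2,1) cmp_Hom[OF \<phi>(1) u(1)] cmp_Hom[OF t(1) \<chi>(1)]] by blast
    have "essential_mono (opcat C) t"
    proof (rule essential_mono_opcatI[OF t(1)])
      show "is_epi C t" using is_epi_cmpD[OF _ p(1) t(1)] c(2) t(2) by simp
      fix D g assume g: "g \<in> Hom C D P" "is_epi C (t \<odot> g)"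
      have "is_epi C (\<chi> \<odot> (t \<odot> g))" using is_epi_cmp[OF g(2) \<chi>e cmp_Hom[OF g(1) t(1)] \<chi>(1)] .
      then have "is_epi C (u \<odot> (\<phi> \<odot> g))"
        using cmp_assoc[OF g(1) t(1) \<chi>(1)] cmp_assoc[OF g(1) \<phi>(1) u(1)] u\<phi> by simp
      then have "is_epi C (\<phi> \<odot> g)" using essential_mono_opcatD[OF essu u(1) cmp_Hom[OF g(1) \<phi>(1)]] by blast
      then have "is_epi C (\<psi> \<odot> (\<phi> \<odot> g))" using is_epi_cmp[OF _ \<psi>e cmp_Hom[OF g(1) \<phi>(1)] \<psi>(1)] by blast
      then show "is_epi C g"
        using cmp_assoc[OF g(1) \<phi>(1) \<psi>(1)] \<psi>\<phi> cmp_ident_left[OF g(1)] by simp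
    qed
    then show ?thesis using t unfolding P_def Q_def by blast
  qed
  show "lies_above C M l k"
    if ex: "\<exists>t \<in> Hom C (cod C p) (cod C c). c = t \<odot> p \<and> essential_mono (opcat C) t"
  proof -
    obtain t where t: "t \<in> Hom C P Q" "c = t \<odot> p" and ess: "essential_mono (opcat C) t"
      using ex[folded P_def Q_def] by blast
    have te: "is_epi C t" using is_epi_cmpD[OF _ p(1) t(1)] c(2) t(2) by simp
    have "c \<odot> k = zero C K Q"
      using t cmp_assoc[OF k(2) p(1) t(1)] p(3) cmp_zero_right[OF t(1)] Hom_obj[OF k(2)] by simp
    then have "sub_le C k l" using sub_le_cokernel_iff[OF sl c0 k(2)] Q_def by simp
    then obtain a where a: "a \<in> Hom C K L" "k = l \<odot> a" using sub_leD[OF _ k(2) l(2)] by blast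
    have pl: "p \<odot> l \<in> Hom C L P" using cmp_Hom[OF l(2) p(1)] .
    \<comment> \<open>J plays the role of L/K, as the image of L in M/K. It remains to see that
      \<open>e\<close> is the cokernel of \<open>a\<close> and \<open>t\<close> the cokernel of
      \<open>m\<close>.\<close>
    obtain J e m where e: "e \<in> Hom C L J" "is_epi C e" and m: "m \<in> Hom C J P" "is_mono C m"
      and me: "p \<odot> l = m \<odot> e"
      by (rule epi_mono_factorization[OF pl])
    have aM: "is_mono C a" using is_mono_cmpD[OF _ a(1) l(2)] k(1) a(2) by simp
    have "is_kernel C e a"
    proof (rule is_kernelI[OF a(1) aM e(1)])
      have "m \<odot> (e \<odot> a) = p \<odot> (l \<odot> a)"
        using cmp_assoc[OF a(1) e(1) m(1)] cmp_assoc[OF a(1) l(2) p(1)] me by simp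
      also have "\<dots> = zero C K P" using a(2) p(3) by simp
      finally show "e \<odot> a = zero C K J" using is_mono_zeroD[OF m(2,1) cmp_Hom[OF a(1) e(1)]] by blast
    next
      fix X x assume x: "x \<in> Hom C X L" "e \<odot> x = zero C X J"
      have "p \<odot> (l \<odot> x) = m \<odot> (e \<odot> x)"
        using cmp_assoc[OF x(1) e(1) m(1)] cmp_assoc[OF x(1) l(2) p(1)] me by simp
      also have "\<dots> = zero C X P" using x(2) cmp_zero_right[OF m(1)] Hom_obj[OF x(1)] by simp
      finally obtain v where v: "v \<in> Hom C X K" "l \<odot> x = k \<odot> v"
        using is_kernelD(4)[OF is_kernel_cokernel[OF k(1) p0] p(1) cmp_Hom[OF x(1) l(2)]] K_def by auto
      have "l \<odot> x = l \<odot> (a \<odot> v)" using v a(2) cmp_assoc[OF v(1) a(1) l(2)] by simp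
      then show "\<exists>h \<in> Hom C X K. x = a \<odot> h"
        using is_monoD[OF l x(1) cmp_Hom[OF v(1) a(1)]] v(1) by blast
    qed
    then have ecok: "is_cokernel C a e" using is_cokernel_kernel e(2) by blast
    have "is_cokernel C m t"
    proof (rule is_cokernelI[OF t(1) te m(1)])
      have "t \<odot> m \<odot> e = t \<odot> p \<odot> l"
        using cmp_assoc[OF e(1) m(1) t(1)] cmp_assoc[OF l(2) p(1) t(1)] me by simp
      also have "\<dots> = zero C L Q" using t(2) c(3) by simp
      finally show "t \<odot> m = zero C J Q" using is_epi_zeroD[OF e(2,1) cmp_Hom[OF m(1) t(1)]] by blast
    next
      fix X g assume g: "g \<in> Hom C P X" "g \<odot> m = zero C J X"
      have "g \<odot> p \<odot> l = g \<odot> m \<odot> e"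
        using cmp_assoc[OF e(1) m(1) g(1)] cmp_assoc[OF l(2) p(1) g(1)] me by simp
      also have "\<dots> = zero C L X" using g(2) cmp_zero_left[OF e(1)] Hom_obj[OF g(1)] by simp
      finally obtain h where h: "h \<in> Hom C Q X" "g \<odot> p = h \<odot> c"
        using c(4)[OF cmp_Hom[OF p(1) g(1)]] by blast
      have "g \<odot> p = h \<odot> t \<odot> p" using h(2) t(2) cmp_assoc[OF p(1) t(1) h(1)] by simp
      then show "\<exists>h \<in> Hom C Q X. g = h \<odot> t"
        using is_epiD[OF p(2,1) g(1) cmp_Hom[OF t(1) h(1)]] h(1) by blast
    qed
    then have sup: "superfluous C P m" using superfluous_iff[OF subobjectI[OF m(2,1)]] ess by blast
    have "m \<in> Hom C (cod C e) (cod C p)" using m(1) HomD(3)[OF e(1)] P_def by simp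
    then show ?thesis
      unfolding lies_above_def
      by (intro conjI sl sk bexI[of _ a] exI[of _ p] exI[of _ e] exI[of _ m])
        (use a p0 ecok me sup K_def L_def P_def in simp_all)
  qed
qed

text \<open>A simple S meets A in zero or in all of S. In the first case A embeds into M/S, hence so
  does M by essentiality, and S would be zero. So A is an upper bound of the simple
  subobjects.\<close>

lemma is_socle_le_essential:
  assumes r: "is_socle C M r" and sa: "subobject C M a" and ess: "essential_mono C a"
  shows "sub_le C r a"
proof -
  define A where "A = dom C a"
  note a = subobjectD[OF sa, folded A_def]
  obtain c where c0: "is_cokernel C a c" using ex_cokernel_Hom[OF a(2)] by blast
  define Q where "Q = cod C c"
  note c = is_cokernelD[OF c0 a(2), folded Q_def]
  have "sub_le C \<sigma> a" if s\<sigma>: "subobject C M \<sigma>" and simple: "simple_obj C (dom C \<sigma>)" for \<sigma>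
  proof -
    define S where "S = dom C \<sigma>"
    note \<sigma> = subobjectD[OF s\<sigma>, folded S_def]
    have c\<sigma>: "c \<odot> \<sigma> \<in> Hom C S Q" using cmp_Hom[OF \<sigma>(2) c(1)] .
    \<comment> \<open>The intersection of S and A, as a subobject of S.\<close>
    obtain z where z0: "is_kernel C (c \<odot> \<sigma>) z" using ex_kernel_Hom[OF c\<sigma>] by blast
    define Z where "Z = dom C z"
    note z = is_kernelD[OF z0 c\<sigma>, folded Z_def]
    consider "is_zero_obj C Z" | "is_iso C z"
      using simple subobjectI[OF z(2,1)] Z_def S_def unfolding simple_obj_def by blast
    then show ?thesis
    proof cases
      case 1
      obtain g where g0: "is_cokernel C \<sigma> g" using ex_cokernel_Hom[OF \<sigma>(2)] by blast
      define G where "G = cod C g"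
      note g = is_cokernelD[OF g0 \<sigma>(2), folded G_def]
      have "is_mono C (g \<odot> a)"
      proof (rule is_mono_cokernel_cmpI[OF \<sigma> g0 a(2)])
        fix Y u v assume u: "u \<in> Hom C Y A" and v: "v \<in> Hom C Y S" and eq: "a \<odot> u = \<sigma> \<odot> v"
        have Y: "Y \<in> obj C" using Hom_obj[OF u] by blast
        have "c \<odot> \<sigma> \<odot> v = c \<odot> a \<odot> u"
          using cmp_assoc[OF v \<sigma>(2) c(1)] cmp_assoc[OF u a(2) c(1)] eq by simp
        also have "\<dots> = zero C Y Q" using c(3) cmp_zero_left[OF u] Hom_obj[OF c(1)] by simp
        finally obtain h where h: "h \<in> Hom C Y Z" "v = z \<odot> h" using z(4)[OF v] by blast
        then have "v = zero C Y S" using is_zero_objD(2)[OF 1 h(1)] cmp_zero_right[OF z(1) Y] by simp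
        then have "a \<odot> u = zero C Y M" using eq cmp_zero_right[OF \<sigma>(2) Y] by simp
        then show "u = zero C Y A" using is_mono_zeroD[OF a u] by blast
      qed
      then have "is_mono C g" using essential_monoD[OF ess a(2) g(1)] by blast
      then have "\<sigma> = zero C S M" using is_mono_zeroD[OF _ g(1) \<sigma>(2) g(3)] by blast
      then have "is_zero_obj C S" using is_zero_obj_dom_mono[OF \<sigma>] by blast
      then show ?thesis using simple S_def unfolding simple_obj_def by blast
    next
      case 2
      have "c \<odot> \<sigma> = zero C S Q" using is_epi_zeroD[OF is_iso_is_epi[OF 2] z(1) c\<sigma> z(3)] .
      then show ?thesis using sub_le_cokernel_iff[OF sa c0 \<sigma>(2)] Q_def by simp
    qed
  qed
  then show ?thesis using r sa unfolding is_socle_def is_sum_def by blast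
qed

text \<open>For a maximal N, the sum N + K is N or M. If it is M, then N \<rightarrow> M/K is epi,
  and superfluity of K forces N = M. The argument is direct because maximality is stated in the
  order of subobjects of M, whereas simplicity is a property of an object.\<close>

lemma superfluous_le_radical:
  assumes r: "is_radical C M r" and sk: "subobject C M k" and k0: "is_cokernel C k e"
    and ess: "essential_mono (opcat C) e"
  shows "sub_le C k r"
proof -
  define K E where "K = dom C k" and "E = cod C e"
  note k = subobjectD[OF sk, folded K_def]
  note e = is_cokernelD[OF k0 k(2), folded E_def]
  have "sub_le C k m" if max: "maximal_subobject C M m" for m
  proof -
    have sm: "subobject C M m" and niso: "\<not> is_iso C m"
      and max': "\<And>l. subobject C M l \<Longrightarrow> sub_le C m l \<Longrightarrow> sub_le C l m \<or> is_iso C l"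
      using max unfolding maximal_subobject_def by auto
    define N where "N = dom C m"
    note m = subobjectD[OF sm, folded N_def]
    obtain c where c0: "is_cokernel C m c" using ex_cokernel_Hom[OF m(2)] by blast
    define Q where "Q = cod C c"
    note c = is_cokernelD[OF c0 m(2), folded Q_def]
    have ck: "c \<odot> k \<in> Hom C K Q" using cmp_Hom[OF k(2) c(1)] .
    obtain x where x0: "is_cokernel C (c \<odot> k) x" using ex_cokernel_Hom[OF ck] by blast
    define X where "X = cod C x"
    note x = is_cokernelD[OF x0 ck, folded X_def]
    have xc: "x \<odot> c \<in> Hom C M X" using cmp_Hom[OF c(1) x(1)] .
    \<comment> \<open>\<open>l\<close> is N + K: the part of M whose class in M/N lies in the image
      of K.\<close>
    obtain l where l0: "is_kernel C (x \<odot> c) l" using ex_kernel_Hom[OF xc] by blast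
    define L where "L = dom C l"
    note l = is_kernelD[OF l0 xc, folded L_def]
    have "sub_le C m l"
      using sub_le_kernel_iff[OF xc l0 m(2)] cmp_assoc[OF m(2) c(1) x(1)] c(3)
        cmp_zero_right[OF x(1)] Hom_obj[OF m(2)] by simp
    then consider "sub_le C l m" | "is_iso C l" using max' subobjectI[OF l(2,1)] by blast
    then show ?thesis
    proof cases
      case 1
      have "sub_le C k l"
        using sub_le_kernel_iff[OF xc l0 k(2)] cmp_assoc[OF k(2) c(1) x(1)] x(3) by simp
      then show ?thesis using sub_le_trans 1 k(2) l(1) m(2) by blast
    next
      case 2
      have xc0: "x \<odot> c = zero C M X" using is_epi_zeroD[OF is_iso_is_epi[OF 2] l(1) xc l(3)] .
      then have x_zero: "x = zero C Q X" using is_epi_zeroD[OF c(2,1) x(1)] by blast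
      have em: "e \<odot> m \<in> Hom C N E" using cmp_Hom[OF m(2) e(1)] .
      have "is_epi C (e \<odot> m)"
      proof (rule is_epiI_zero[OF em])
        fix Y g assume g: "g \<in> Hom C E Y" "g \<odot> (e \<odot> m) = zero C N Y"
        have ge: "g \<odot> e \<in> Hom C M Y" using cmp_Hom[OF e(1) g(1)] .
        have Y: "Y \<in> obj C" using Hom_obj[OF ge] by blast
        have "g \<odot> e \<odot> m = zero C N Y" using cmp_assoc[OF m(2) e(1) g(1)] g(2) by simp
        then obtain h where h: "h \<in> Hom C Q Y" "g \<odot> e = h \<odot> c" using c(4)[OF ge] by blast
        have "h \<odot> (c \<odot> k) = g \<odot> (e \<odot> k)"
          using cmp_assoc[OF k(2) c(1) h(1)] cmp_assoc[OF k(2) e(1) g(1)] h(2) by simp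
        also have "\<dots> = zero C K Y" using e(3) cmp_zero_right[OF g(1)] Hom_obj[OF k(2)] by simp
        finally obtain h' where h': "h' \<in> Hom C X Y" "h = h' \<odot> x" using x(4)[OF h(1)] by blast
        then have "h = zero C Q Y" using x_zero cmp_zero_right[OF h'(1)] Hom_obj[OF h(1)] by simp
        then have "g \<odot> e = zero C M Y" using h(2) cmp_zero_left[OF c(1) Y] by simp
        then show "g = zero C E Y" using is_epi_zeroD[OF e(2,1) g(1)] by blast
      qed
      then have "is_epi C m" using essential_mono_opcatD[OF ess e(1) m(2)] by blast
      then show ?thesis using is_isoI[OF m(1)] niso by blast
    qed
  qed
  then show ?thesis using r sk unfolding is_radical_def is_intersection_def by blast
qed

section \<open>Intersections of essential subobjects\<close>

text \<open>The intersection of R and L is essential in L, being the preimage of R, and it lies in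
  every S_i, hence in K. Essentiality in L then passes to the larger K.\<close>

lemma essential_intersection:
  assumes sr: "subobject C M r" and essr: "essential_mono C r"
    and r_le: "\<And>e. subobject C M e \<Longrightarrow> essential_mono C e \<Longrightarrow> sub_le C r e"
    and d: "\<And>i. i \<in> I \<Longrightarrow> d i \<in> Hom C (dom C (d i)) M"
    and p: "\<And>i. i \<in> I \<Longrightarrow> \<exists>p \<in> Hom C M (dom C (d i)). p \<odot> d i = ident C (dom C (d i))"
    and a: "\<And>i. i \<in> I \<Longrightarrow> \<exists>a \<in> Hom C (dom C (s i)) (dom C (d i)). s i = d i \<odot> a \<and> essential_mono C a"
    and k: "is_intersection C M (s ` I) k" and l: "is_intersection C M (d ` I) l"
  shows "\<exists>b \<in> Hom C (dom C k) (dom C l). k = l \<odot> b \<and> essential_mono C b"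
proof -
  define K L R where "K = dom C k" and "L = dom C l" and "R = dom C r"
  have kl: "subobject C M k" "subobject C M l" using k l unfolding is_intersection_def by auto
  note kH = subobjectD[OF kl(1), folded K_def] and lH = subobjectD[OF kl(2), folded L_def]
    and rH = subobjectD[OF sr, folded R_def]
  have s: "s i \<in> Hom C (dom C (s i)) M" if "i \<in> I" for i using a[OF that] d[OF that] cmp_Hom by metis
  \<comment> \<open>The inclusion of R \<inter> D_i in S_i, stated for an arbitrary arrow
    \<open>x\<close> into M, so that R \<inter> D_i need not be formed.\<close>
  have meet: "sub_le C x (s i)"
    if i: "i \<in> I" and x: "x \<in> Hom C X M" and xr: "sub_le C x r" and xd: "sub_le C x (d i)" for i x X
  proof -
    define D A where "D = dom C (d i)" and "A = dom C (s i)"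
    obtain q where q: "q \<in> Hom C M D" "q \<odot> d i = ident C D" using p[OF i] D_def by blast
    obtain b where b: "b \<in> Hom C A D" "s i = d i \<odot> b" "essential_mono C b"
      using a[OF i] D_def A_def by blast
    have dH: "d i \<in> Hom C D M" and sH: "s i \<in> Hom C A M" using d s i D_def A_def by auto
    obtain c where c0: "is_cokernel C b c" using ex_cokernel_Hom[OF b(1)] by blast
    define Q where "Q = cod C c"
    have c: "c \<in> Hom C D Q" using is_cokernelD(1)[OF c0 b(1)] Q_def by simp
    have cq: "c \<odot> q \<in> Hom C M Q" using cmp_Hom[OF q(1) c] .
    \<comment> \<open>The preimage of S_i under the retraction \<open>q\<close>.\<close>
    obtain e where e0: "is_kernel C (c \<odot> q) e" using ex_kernel_Hom[OF cq] by blast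
    note e = is_kernelD[OF e0 cq]
    have "sub_le C r e"
      using r_le[OF subobjectI[OF e(2,1)]] essential_mono_preimage[OF b(3,1) q(1) c0 e0] by blast
    then have "sub_le C x e" using sub_le_trans xr x rH(2) e(1) by blast
    then have cqx: "c \<odot> q \<odot> x = zero C X Q" using sub_le_kernel_iff[OF cq e0 x] by simp
    obtain w where w: "w \<in> Hom C X D" "x = d i \<odot> w" using sub_leD[OF xd x dH] by blast
    \<comment> \<open>The retraction is the identity on D_i, so membership of \<open>x\<close> in
      the preimage says that \<open>w\<close> itself lands in S_i.\<close>
    have "q \<odot> x = w"
      using w cmp_assoc[OF w(1) dH q(1)] q(2) cmp_ident_left[OF w(1)] by simp
    then have "c \<odot> w = zero C X Q" using cqx cmp_assoc[OF x q(1) c] by simp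
    then have "sub_le C w b"
      using sub_le_cokernel_iff[OF subobjectI[OF essential_mono_is_mono[OF b(3)] b(1)] c0 w(1)] Q_def
      by simp
    then obtain v where v: "v \<in> Hom C X A" "w = b \<odot> v" using sub_leD[OF _ w(1) b(1)] by blast
    have "x = s i \<odot> v" using w(2) v(2) b(2) cmp_assoc[OF v(1) b(1) dH] by simp
    then show ?thesis using sub_leI[OF v(1) sH] by blast
  qed
  have "sub_le C k (d i)" if i: "i \<in> I" for i
  proof -
    have "sub_le C k (s i)" using k i unfolding is_intersection_def by blast
    moreover have "sub_le C (s i) (d i)" using a[OF i] sub_leI d[OF i] by blast
    ultimately show ?thesis using sub_le_trans kH(2) s[OF i] d[OF i] by blast
  qed
  then have "sub_le C k l" using l kl unfolding is_intersection_def by blast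
  then obtain b where b: "b \<in> Hom C K L" "k = l \<odot> b" using sub_leD kH(2) lH(2) by blast
  have "essential_mono C b"
  proof (rule essential_monoI[OF b(1)])
    show "is_mono C b" using is_mono_cmpD[OF _ b(1) lH(2)] kH(1) b(2) by simp
    fix D g assume g: "g \<in> Hom C L D" "is_mono C (g \<odot> b)"
    obtain c where c0: "is_cokernel C r c" using ex_cokernel_Hom[OF rH(2)] by blast
    note c = is_cokernelD(1)[OF c0 rH(2)]
    have cl: "c \<odot> l \<in> Hom C L (cod C c)" using cmp_Hom[OF lH(2) c] .
    \<comment> \<open>The intersection of R and L, as a subobject of L.\<close>
    obtain w where w0: "is_kernel C (c \<odot> l) w" using ex_kernel_Hom[OF cl] by blast
    define W where "W = dom C w"
    note w = is_kernelD[OF w0 cl, folded W_def]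
    have essw: "essential_mono C w" using essential_mono_preimage[OF essr rH(2) lH(2) c0 w0] .
    have lw: "l \<odot> w \<in> Hom C W M" using cmp_Hom[OF w(1) lH(2)] .
    have lwr: "sub_le C (l \<odot> w) r"
      using sub_le_cokernel_iff[OF sr c0 lw] cmp_assoc[OF w(1) lH(2) c] w(3) by simp
    have "sub_le C (l \<odot> w) (s i)" if i: "i \<in> I" for i
    proof (rule meet[OF i lw lwr])
      have "sub_le C l (d i)" using l i unfolding is_intersection_def by blast
      then show "sub_le C (l \<odot> w) (d i)"
        using sub_le_trans[OF _ _ lw lH(2) d[OF i]] sub_leI[OF w(1) lH(2)] by blast
    qed
    then have "sub_le C (l \<odot> w) k"
      using k subobjectI[OF is_mono_cmp[OF w(2) lH(1) w(1) lH(2)] lw] unfolding is_intersection_def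
      by blast
    then obtain v where v: "v \<in> Hom C W K" "l \<odot> w = k \<odot> v" using sub_leD[OF _ lw kH(2)] by blast
    have "l \<odot> w = l \<odot> (b \<odot> v)" using v(2) b(2) cmp_assoc[OF v(1) b(1) lH(2)] by simp
    then have wbv: "w = b \<odot> v" using is_monoD[OF lH w(1) cmp_Hom[OF v(1) b(1)]] by blast
    have "is_mono C v" using is_mono_cmpD[OF _ v(1) b(1)] w(2) wbv by simp
    then have "is_mono C (g \<odot> b \<odot> v)" using is_mono_cmp[OF _ g(2) v(1) cmp_Hom[OF b(1) g(1)]] by blast
    then have "is_mono C (g \<odot> w)" using cmp_assoc[OF v(1) b(1) g(1)] wbv by simp
    then show "is_mono C g" using essential_monoD[OF essw w(1) g(1)] by blast
  qed
  then show ?thesis using b K_def L_def by blast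
qed

section \<open>CS-Rickart and CS-Baer objects\<close>

text \<open>\<open>q\<close> is the projection onto the complement. Since the identity is the sum of
  \<open>d \<odot> p\<close> and \<open>l \<odot> q\<close>, an arrow killed by \<open>q\<close>
  equals its part through \<open>d\<close>; so \<open>d\<close> is the kernel of the split
  epimorphism \<open>q\<close>, and \<open>q\<close> its cokernel.\<close>

lemma direct_summandD:
  assumes "direct_summand C M d"
  obtains l p q where "l \<in> Hom C (cod C q) M" "p \<in> Hom C M (dom C d)" "q \<in> Hom C M (cod C q)"
    "p \<odot> d = ident C (dom C d)" "q \<odot> l = ident C (cod C q)"
    "is_kernel C q d" "is_cokernel C d q"
proof -
  define D where "D = dom C d"
  obtain l p q where sd: "subobject C M d" and b: "is_biproduct C D (dom C l) M d l p q"
    using assms D_def unfolding direct_summand_def by blast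
  define L where "L = dom C l"
  have H: "d \<in> Hom C D M" "l \<in> Hom C L M" "p \<in> Hom C M D" "q \<in> Hom C M L"
    and pd: "p \<odot> d = ident C D" and ql: "q \<odot> l = ident C L" and qd: "q \<odot> d = zero C D L"
    and sum: "add C (d \<odot> p) (l \<odot> q) = ident C M"
    using b unfolding is_biproduct_def L_def by auto
  have dp: "d \<odot> p \<in> Hom C M M" and lq: "l \<odot> q \<in> Hom C M M" using H cmp_Hom by blast+
  have M: "M \<in> obj C" using Hom_obj[OF H(1)] by blast
  have dM: "is_mono C d" using subobjectD[OF sd] by blast
  have qE: "is_epi C q" using is_epi_split[OF H(4,2) ql] .
  have ker: "is_kernel C q d"
  proof (rule is_kernelI[OF H(1) dM H(4) qd])
    fix X g assume g: "g \<in> Hom C X M" "q \<odot> g = zero C X L"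
    have "g = ident C M \<odot> g" using cmp_ident_left[OF g(1)] by simp
    also have "\<dots> = add C (d \<odot> p \<odot> g) (l \<odot> q \<odot> g)"
      using cmp_add_left[OF g(1) dp lq] sum by simp
    also have "l \<odot> q \<odot> g = zero C X M"
      using cmp_assoc[OF g(1) H(4,2)] g(2) cmp_zero_right[OF H(2)] Hom_obj[OF g(1)] by simp
    also have "add C (d \<odot> p \<odot> g) (zero C X M) = d \<odot> (p \<odot> g)"
      using add_zero_right[OF cmp_Hom[OF g(1) dp]] cmp_assoc[OF g(1) H(3,1)] by simp
    finally show "\<exists>h \<in> Hom C X D. g = d \<odot> h" using cmp_Hom[OF g(1) H(3)] by blast
  qed
  have "q \<in> Hom C M (cod C q)" "l \<in> Hom C (cod C q) M" "q \<odot> l = ident C (cod C q)"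
    using H ql HomD(3)[OF H(4)] by auto
  then show thesis using that[OF _ _ _ _ _ ker is_cokernel_kernel[OF qE ker]] H(3) pd D_def by simp
qed

section \<open>Independence of the monomorphisms representing kernels and images\<close>

lemma is_kernel_eq:
  assumes f: "is_kernel C f k" "f \<in> Hom C M N" and l: "subobject C M l"
    and le: "sub_le C l k" "sub_le C k l"
  shows "is_kernel C f l"
proof -
  define K L where "K = dom C k" and "L = dom C l"
  note k = is_kernelD[OF f, folded K_def] and lH = subobjectD[OF l, folded L_def]
  obtain a where a: "a \<in> Hom C K L" "k = l \<odot> a" using sub_leD[OF le(2) k(1) lH(2)] by blast
  show ?thesis
  proof (rule is_kernelI[OF lH(2,1) f(2)])
    show "f \<odot> l = zero C L N" using sub_le_kernel_iff[OF f(2,1) lH(2)] le(1) by simp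
    fix X g assume g: "g \<in> Hom C X M" "f \<odot> g = zero C X N"
    obtain h where h: "h \<in> Hom C X K" "g = k \<odot> h" using k(4)[OF g] by blast
    then have "g = l \<odot> (a \<odot> h)" using cmp_assoc[OF h(1) a(1) lH(2)] a(2) by simp
    then show "\<exists>h \<in> Hom C X L. g = l \<odot> h" using cmp_Hom[OF h(1) a(1)] by blast
  qed
qed

lemma is_kernel_subobject: "is_kernel C f k \<Longrightarrow> f \<in> Hom C M N \<Longrightarrow> subobject C M k"
  using is_kernelD(1,2) subobjectI by blast

lemma is_kernel_sub_le:
  assumes "is_kernel C f k" "is_kernel C f l" "f \<in> Hom C M N"
  shows "sub_le C k l"
  using sub_le_kernel_iff[OF assms(3,2)] is_kernelD[OF assms(1,3)] by blast

lemma is_image_subobject: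
  assumes "is_image C f m" "f \<in> Hom C N M"
  shows "subobject C M m"
  using assms is_cokernelD(1) is_kernel_subobject unfolding is_image_def by blast

lemma is_image_sub_le:
  assumes f: "f \<in> Hom C N M" and j: "is_image C f j" and k: "is_image C f k"
  shows "sub_le C j k"
proof -
  obtain c where c: "is_cokernel C f c" "is_kernel C c j" using j unfolding is_image_def by blast
  obtain d where d: "is_cokernel C f d" "is_kernel C d k" using k unfolding is_image_def by blast
  note cH = is_cokernelD[OF c(1) f] and dH = is_cokernelD[OF d(1) f]
  note jH = is_kernelD[OF c(2) cH(1)]
  obtain h where h: "h \<in> Hom C (cod C c) (cod C d)" "d = h \<odot> c" using cH(4)[OF dH(1,3)] by blast
  have "d \<odot> j = zero C (dom C j) (cod C d)"
    using h(2) cmp_assoc[OF jH(1) cH(1) h(1)] jH(3) cmp_zero_right[OF h(1)] Hom_obj[OF jH(1)] by simp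
  then show ?thesis using sub_le_kernel_iff[OF dH(1) d(2) jH(1)] by simp
qed

lemma ex_image:
  assumes "f \<in> Hom C A B"
  shows "\<exists>m. is_image C f m"
  using ex_cokernel_Hom[OF assms] is_cokernelD(1)[OF _ assms] ex_kernel_Hom
  unfolding is_image_def by meson

lemma is_intersection_cong:
  assumes "\<And>l. subobject C M l \<Longrightarrow> (\<forall>s \<in> S. sub_le C l s) \<longleftrightarrow> (\<forall>s \<in> T. sub_le C l s)"
  shows "is_intersection C M S k \<longleftrightarrow> is_intersection C M T k"
  using assms unfolding is_intersection_def by blast

lemma is_sum_cong:
  assumes "\<And>l. subobject C M l \<Longrightarrow> (\<forall>s \<in> S. sub_le C s l) \<longleftrightarrow> (\<forall>s \<in> T. sub_le C s l)"
  shows "is_sum C M S k \<longleftrightarrow> is_sum C M T k"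
  using assms unfolding is_sum_def by blast

text \<open>Containment in a kernel depends only on the arrow \<open>f i\<close>, so all
  representatives have the same lower bounds and one chosen \<open>s i\<close> per index
  suffices.\<close>

lemma is_intersection_kernels:
  assumes "\<And>i. i \<in> I \<Longrightarrow> f i \<in> Hom C M N" "\<And>i. i \<in> I \<Longrightarrow> is_kernel C (f i) (s i)"
  shows "is_intersection C M {j. \<exists>i \<in> I. is_kernel C (f i) j} k \<longleftrightarrow> is_intersection C M (s ` I) k"
proof (rule is_intersection_cong)
  fix l assume "subobject C M l"
  then have l: "l \<in> Hom C (dom C l) M" using subobjectD by blast
  have "sub_le C l j \<longleftrightarrow> sub_le C l (s i)" if "i \<in> I" "is_kernel C (f i) j" for i j
    using sub_le_kernel_iff[OF assms(1) _ l] assms(2) that by blast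
  then show "(\<forall>j \<in> {j. \<exists>i \<in> I. is_kernel C (f i) j}. sub_le C l j) \<longleftrightarrow> (\<forall>j \<in> s ` I. sub_le C l j)"
    using assms(2) by blast
qed

lemma is_sum_images:
  assumes f: "\<And>i. i \<in> I \<Longrightarrow> f i \<in> Hom C N M" and s: "\<And>i. i \<in> I \<Longrightarrow> is_image C (f i) (s i)"
  shows "is_sum C M {j. \<exists>i \<in> I. is_image C (f i) j} k \<longleftrightarrow> is_sum C M (s ` I) k"
proof (rule is_sum_cong)
  fix l assume "subobject C M l"
  then have l: "l \<in> Hom C (dom C l) M" using subobjectD by blast
  have "sub_le C j l" if i: "i \<in> I" and j: "is_image C (f i) j" and "sub_le C (s i) l" for i j
  proof (rule sub_le_trans)
    show "sub_le C j (s i)" using is_image_sub_le f s i j by blast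
    show "j \<in> Hom C (dom C j) M" "s i \<in> Hom C (dom C (s i)) M"
      using is_image_subobject f s i j subobjectD(2) by blast+
  qed fact+
  then show "(\<forall>j \<in> {j. \<exists>i \<in> I. is_image C (f i) j}. sub_le C j l) \<longleftrightarrow> (\<forall>j \<in> s ` I. sub_le C j l)"
    using s by blast
qed

text \<open>Two predicates are used because \<open>strictly_SSIP_extending\<close> starts from plain
  summands (\<open>D\<close>) and ends with fully invariant ones (\<open>E\<close>); without the
  words in parentheses both are the same.\<close>

lemma CS_Baer_of_CS_Rickart:
  assumes rickart: "\<forall>f \<in> Hom C M M. \<exists>k. is_kernel C f k \<and> E k"
    and E: "\<And>k. E k \<Longrightarrow> D k"
    and meets: "\<forall>I s. small U I \<and> (\<forall>i \<in> I. subobject C M (s i) \<and> D (s i)) \<longrightarrow>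
      (\<exists>k. is_intersection C M (s ` I) k \<and> E k)"
  shows "\<forall>I f. small U I \<and> (\<forall>i \<in> I. f i \<in> Hom C M M) \<longrightarrow>
    (\<exists>k. is_intersection C M {j. \<exists>i \<in> I. is_kernel C (f i) j} k \<and> E k)"
proof (intro allI impI, elim conjE)
  fix I f assume I: "small U I" and f: "\<forall>i \<in> I. f i \<in> Hom C M M"
  have "\<forall>i \<in> I. \<exists>k. is_kernel C (f i) k \<and> D k" using rickart E f by blast
  then obtain s where s: "\<forall>i \<in> I. is_kernel C (f i) (s i) \<and> D (s i)" by (rule bchoice[THEN exE])
  then have "\<forall>i \<in> I. subobject C M (s i) \<and> D (s i)" using is_kernel_subobject f by blast
  then have "\<exists>k. is_intersection C M (s ` I) k \<and> E k" using meets I by blast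
  then show "\<exists>k. is_intersection C M {j. \<exists>i \<in> I. is_kernel C (f i) j} k \<and> E k"
    using is_intersection_kernels[of I f M M s] f s by simp
qed

lemma dual_CS_Baer_of_dual_CS_Rickart:
  assumes rickart: "\<forall>f \<in> Hom C M M. \<exists>k. is_image C f k \<and> E k"
    and E: "\<And>k. E k \<Longrightarrow> D k"
    and meets: "\<forall>I s. small U I \<and> (\<forall>i \<in> I. subobject C M (s i) \<and> D (s i)) \<longrightarrow>
      (\<exists>k. is_sum C M (s ` I) k \<and> E k)"
  shows "\<forall>I f. small U I \<and> (\<forall>i \<in> I. f i \<in> Hom C M M) \<longrightarrow>
    (\<exists>k. is_sum C M {j. \<exists>i \<in> I. is_image C (f i) j} k \<and> E k)"
proof (intro allI impI, elim conjE)
  fix I f assume I: "small U I" and f: "\<forall>i \<in> I. f i \<in> Hom C M M"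
  have "\<forall>i \<in> I. \<exists>k. is_image C (f i) k \<and> D k" using rickart E f by blast
  then obtain s where s: "\<forall>i \<in> I. is_image C (f i) (s i) \<and> D (s i)" by (rule bchoice[THEN exE])
  then have "\<forall>i \<in> I. subobject C M (s i) \<and> D (s i)" using is_image_subobject f by blast
  then have "\<exists>k. is_sum C M (s ` I) k \<and> E k" using meets I by blast
  then show "\<exists>k. is_sum C M {j. \<exists>i \<in> I. is_image C (f i) j} k \<and> E k"
    using is_sum_images[of I f M M s] f s by simp
qed

text \<open>A one-member family is small. The Baer condition returns some representative of the
  infimum, and this is shown to be a kernel of \<open>f\<close> itself; thus \<open>E\<close> is
  never moved between equivalent monomorphisms.\<close>

lemma CS_Rickart_of_CS_Baer:
  assumes "infinite U"
    and baer: "\<forall>I f. small U I \<and> (\<forall>i \<in> I. f i \<in> Hom C M M) \<longrightarrow>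
      (\<exists>k. is_intersection C M {j. \<exists>i \<in> I. is_kernel C (f i) j} k \<and> E k)"
  shows "\<forall>f \<in> Hom C M M. \<exists>k. is_kernel C f k \<and> E k"
proof
  fix f assume f: "f \<in> Hom C M M"
  obtain i where "i \<in> U" using assms(1) by fastforce
  then obtain k where k: "is_intersection C M {j. is_kernel C f j} k" "E k"
    using baer[rule_format, of "{i}" "\<lambda>_. f"] small_singleton[OF assms(1)] f by auto
  obtain k' where k': "is_kernel C f k'" using ex_kernel_Hom[OF f] by blast
  have "sub_le C k k'" "subobject C M k" using k(1) k' unfolding is_intersection_def by blast+
  moreover have "sub_le C k' k"
    using k(1) is_kernel_sub_le[OF k' _ f] is_kernel_subobject[OF k' f] unfolding is_intersection_def
    by blast
  ultimately show "\<exists>k. is_kernel C f k \<and> E k" using is_kernel_eq[OF k' f] k(2) by blast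
qed

text \<open>An image is a kernel of a cokernel \<open>c\<close>, so a representative equivalent to
  it is again a kernel of the same \<open>c\<close>.\<close>

lemma dual_CS_Rickart_of_dual_CS_Baer:
  assumes "infinite U"
    and baer: "\<forall>I f. small U I \<and> (\<forall>i \<in> I. f i \<in> Hom C M M) \<longrightarrow>
      (\<exists>l. is_sum C M {j. \<exists>i \<in> I. is_image C (f i) j} l \<and> E l)"
  shows "\<forall>f \<in> Hom C M M. \<exists>l. is_image C f l \<and> E l"
proof
  fix f assume f: "f \<in> Hom C M M"
  obtain i where "i \<in> U" using assms(1) by fastforce
  then obtain l where l: "is_sum C M {j. is_image C f j} l" "E l"
    using baer[rule_format, of "{i}" "\<lambda>_. f"] small_singleton[OF assms(1)] f by auto
  obtain l' where l': "is_image C f l'" using ex_image[OF f] by blast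
  then obtain c where c: "is_cokernel C f c" "is_kernel C c l'" unfolding is_image_def by blast
  have "sub_le C l' l" "subobject C M l" using l(1) l' unfolding is_sum_def by blast+
  moreover have "sub_le C l l'"
    using l(1) is_image_sub_le[OF f _ l'] is_image_subobject[OF l' f] unfolding is_sum_def by blast
  ultimately have "is_kernel C c l" using is_kernel_eq[OF c(2) is_cokernelD(1)[OF c(1) f]] by blast
  then show "\<exists>l. is_image C f l \<and> E l" using c(1) l(2) unfolding is_image_def by blast
qed

text \<open>\<open>P\<close> stands for direct summands or for fully invariant ones. The Baer
  condition makes the intersection L of the D_i essential in some \<open>e\<close> with
  \<open>P e\<close>; the intersection of the S_i is essential in L, hence in
  \<open>e\<close>.\<close>

lemma SSIP_of_CS_Baer:
  assumes "AB3_star C U" and M: "M \<in> obj C"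
    and soc: "is_socle C M r" "essential C M r"
    and baer: "\<forall>I f. small U I \<and> (\<forall>i \<in> I. f i \<in> Hom C M M) \<longrightarrow>
      (\<exists>k. is_intersection C M {j. \<exists>i \<in> I. is_kernel C (f i) j} k \<and> (\<exists>d. P d \<and> essential_in C k d))"
    and P: "\<And>d. P d \<Longrightarrow> subobject C M d"
  shows "\<forall>I s. small U I \<and> (\<forall>i \<in> I. subobject C M (s i) \<and> ess_in_summand C M (s i)) \<longrightarrow>
    (\<exists>k. is_intersection C M (s ` I) k \<and> (\<exists>d. P d \<and> essential_in C k d))"
proof (intro allI impI, elim conjE)
  fix I s assume I: "small U I" and s: "\<forall>i \<in> I. subobject C M (s i) \<and> ess_in_summand C M (s i)"
  have "\<forall>i \<in> I. \<exists>d. direct_summand C M d \<and> essential_in C (s i) d"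
    using s unfolding ess_in_summand_def by blast
  then obtain d where d: "\<forall>i \<in> I. direct_summand C M (d i) \<and> essential_in C (s i) (d i)"
    by (rule bchoice[THEN exE])
  have dH: "d i \<in> Hom C (dom C (d i)) M" if "i \<in> I" for i
    using d that subobjectD(2) unfolding direct_summand_def by blast
  have "\<exists>f \<in> Hom C M M. is_kernel C f (d i) \<and>
      (\<exists>p \<in> Hom C M (dom C (d i)). p \<odot> d i = ident C (dom C (d i)))" if i: "i \<in> I" for i
  proof -
    have "direct_summand C M (d i)" using d i by blast
    then obtain l p q where l: "l \<in> Hom C (cod C q) M" and p: "p \<in> Hom C M (dom C (d i))"
      and q: "q \<in> Hom C M (cod C q)" and pd: "p \<odot> d i = ident C (dom C (d i))"
      and ql: "q \<odot> l = ident C (cod C q)" and k: "is_kernel C q (d i)" "is_cokernel C (d i) q"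
      by (rule direct_summandD)
    have lM: "is_mono C l" using is_mono_split[OF l q ql] .
    note kD = is_kernelD[OF k(1) q]
    have lq: "l \<odot> q \<in> Hom C M M" using cmp_Hom[OF q l] .
    \<comment> \<open>The Baer condition speaks of endomorphisms of M, so \<open>q\<close> is
      followed by its section \<open>l\<close>; as \<open>l\<close> is mono, the kernel is still
      \<open>d i\<close>.\<close>
    have "is_kernel C (l \<odot> q) (d i)"
    proof (rule is_kernelI[OF kD(1,2) lq])
      show "l \<odot> q \<odot> d i = zero C (dom C (d i)) M"
        using cmp_assoc[OF kD(1) q l] kD(3) cmp_zero_right[OF l] Hom_obj[OF kD(1)] by simp
      fix X g assume g: "g \<in> Hom C X M" "l \<odot> q \<odot> g = zero C X M"
      have "l \<odot> (q \<odot> g) = zero C X M" using cmp_assoc[OF g(1) q l] g(2) by simp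
      then show "\<exists>h \<in> Hom C X (dom C (d i)). g = d i \<odot> h"
        using is_mono_zeroD[OF lM l cmp_Hom[OF g(1) q]] kD(4)[OF g(1)] by blast
    qed
    then show ?thesis using lq p pd by blast
  qed
  then have "\<forall>i \<in> I. \<exists>f. f \<in> Hom C M M \<and> is_kernel C f (d i)"
    and ret: "\<And>i. i \<in> I \<Longrightarrow> \<exists>p \<in> Hom C M (dom C (d i)). p \<odot> d i = ident C (dom C (d i))"
    by blast+
  then obtain f where f: "\<forall>i \<in> I. f i \<in> Hom C M M \<and> is_kernel C (f i) (d i)"
    using bchoice[of I "\<lambda>i f. f \<in> Hom C M M \<and> is_kernel C f (d i)"] by blast
  then obtain l e where l: "is_intersection C M {j. \<exists>i \<in> I. is_kernel C (f i) j} l"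
    and e: "P e" "essential_in C l e"
    using baer I f by blast
  have l': "is_intersection C M (d ` I) l" using is_intersection_kernels[of I f M M d] f l by simp
  obtain k where k: "is_intersection C M (s ` I) k" using ex_intersection[OF assms(1) I M] s by blast
  have "\<exists>b \<in> Hom C (dom C k) (dom C l). k = l \<odot> b \<and> essential_mono C b"
  proof (rule essential_intersection[OF _ _ _ dH ret _ k l'])
    show "subobject C M r" "essential_mono C r" using soc(2) essential_iff by blast+
    show "sub_le C r a" if "subobject C M a" "essential_mono C a" for a
      using is_socle_le_essential[OF soc(1)] that by blast
    show "\<exists>a \<in> Hom C (dom C (s i)) (dom C (d i)). s i = d i \<odot> a \<and> essential_mono C a"
      if "i \<in> I" for i
      using d that essential_iff unfolding essential_in_def by blast
  qed
  then obtain b where b: "b \<in> Hom C (dom C k) (dom C l)" "k = l \<odot> b" "essential_mono C b" by blast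
  obtain a where a: "a \<in> Hom C (dom C l) (dom C e)" "l = e \<odot> a" "essential_mono C a"
    using e(2) essential_iff unfolding essential_in_def by blast
  have lH: "l \<in> Hom C (dom C l) M" using l subobjectD unfolding is_intersection_def by blast
  have eH: "e \<in> Hom C (dom C e) M" using P[OF e(1)] subobjectD by blast
  have ba: "a \<odot> b \<in> Hom C (dom C k) (dom C e)" using cmp_Hom[OF b(1) a(1)] .
  have ess: "essential_mono C (a \<odot> b)" using essential_mono_cmp[OF b(3) a(3) b(1) a(1)] .
  have "k = e \<odot> (a \<odot> b)" using b(2) a(2) cmp_assoc[OF b(1) a(1) eH] by simp
  then have "essential_in C k e"
    using ba essential_iff subobjectI[OF essential_mono_is_mono[OF ess] ba] ess
    unfolding essential_in_def by blast
  then show "\<exists>k. is_intersection C M (s ` I) k \<and> (\<exists>d. P d \<and> essential_in C k d)"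
    using k e(1) by blast
qed

text \<open>The arrows M/L \<rightarrow> M/K \<rightarrow> M/J compose, and transitivity of
  essential monomorphisms applies to them in the opposite category.\<close>

lemma lies_above_trans:
  assumes jk: "lies_above C M j k" and kl: "lies_above C M k l"
  shows "lies_above C M j l"
proof -
  interpret op: abelian_category "opcat C" by (rule abelian_category_op)
  have sub: "subobject C M j" "subobject C M k" "subobject C M l"
    using jk kl unfolding lies_above_def by auto
  obtain cj where cj: "is_cokernel C j cj" using ex_cokernel_Hom[OF subobjectD(2)[OF sub(1)]] by blast
  obtain ck where ck: "is_cokernel C k ck" using ex_cokernel_Hom[OF subobjectD(2)[OF sub(2)]] by blast
  obtain cl where cl: "is_cokernel C l cl" using ex_cokernel_Hom[OF subobjectD(2)[OF sub(3)]] by blast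
  obtain t where t: "t \<in> Hom C (cod C ck) (cod C cj)" "cj = t \<odot> ck" "essential_mono (opcat C) t"
    using lies_above_iff[OF sub(1,2) ck cj] jk by blast
  obtain u where u: "u \<in> Hom C (cod C cl) (cod C ck)" "ck = u \<odot> cl" "essential_mono (opcat C) u"
    using lies_above_iff[OF sub(2,3) cl ck] kl by blast
  have clH: "cl \<in> Hom C M (cod C cl)" using is_cokernelD(1)[OF cl subobjectD(2)[OF sub(3)]] .
  have "essential_mono (opcat C) (t \<odot> u)"
    using op.essential_mono_cmp[of t u "cod C cj" "cod C ck" "cod C cl"] t u by simp
  moreover have "cj = t \<odot> u \<odot> cl"
    unfolding cmp_assoc[OF clH u(1) t(1)] using t(2) u(2) by simp
  ultimately show ?thesis using lies_above_iff[OF sub(1,3) cl cj] cmp_Hom[OF u(1) t(1)] by blast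
qed

text \<open>\<open>essential_intersection\<close> is used in the opposite category with M/S_i, M/D_i
  and M/Rad M in place of S_i, D_i and the socle. Sections of M \<rightarrow> M/D_i serve there as
  the retractions.\<close>

lemma SSSP_of_dual_CS_Baer:
  assumes "AB3 C U" and M: "M \<in> obj C"
    and rad: "is_radical C M r" "superfluous C M r"
    and baer: "\<forall>I f. small U I \<and> (\<forall>i \<in> I. f i \<in> Hom C M M) \<longrightarrow>
      (\<exists>l. is_sum C M {j. \<exists>i \<in> I. is_image C (f i) j} l \<and> (\<exists>d. P d \<and> lies_above C M l d))"
  shows "\<forall>I s. small U I \<and> (\<forall>i \<in> I. subobject C M (s i) \<and> above_summand C M (s i)) \<longrightarrow>
    (\<exists>l. is_sum C M (s ` I) l \<and> (\<exists>d. P d \<and> lies_above C M l d))"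
proof (intro allI impI, elim conjE)
  fix I s assume I: "small U I" and s: "\<forall>i \<in> I. subobject C M (s i) \<and> above_summand C M (s i)"
  interpret op: abelian_category "opcat C" by (rule abelian_category_op)
  have "\<forall>i \<in> I. \<exists>d. direct_summand C M d \<and> lies_above C M (s i) d"
    using s unfolding above_summand_def by blast
  then obtain d where d: "\<forall>i \<in> I. direct_summand C M (d i) \<and> lies_above C M (s i) (d i)"
    by (rule bchoice[THEN exE])
  have sd: "subobject C M (d i)" if "i \<in> I" for i
    using d that unfolding direct_summand_def by blast
  have "\<exists>q f. q \<in> Hom C M (cod C q) \<and> is_cokernel C (d i) q \<and>
      (\<exists>l \<in> Hom C (cod C q) M. q \<odot> l = ident C (cod C q)) \<and>
      f \<in> Hom C M M \<and> is_image C f (d i)" if i: "i \<in> I" for i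
  proof -
    have "direct_summand C M (d i)" using d i by blast
    then obtain l p q where l: "l \<in> Hom C (cod C q) M" and p: "p \<in> Hom C M (dom C (d i))"
      and q: "q \<in> Hom C M (cod C q)" and pd: "p \<odot> d i = ident C (dom C (d i))"
      and ql: "q \<odot> l = ident C (cod C q)" and k: "is_kernel C q (d i)" "is_cokernel C (d i) q"
      by (rule direct_summandD)
    note kD = is_kernelD[OF k(1) q]
    note qD = is_cokernelD[OF k(2) kD(1)]
    have pE: "is_epi C p" using is_epi_split[OF p kD(1) pd] .
    have dp: "d i \<odot> p \<in> Hom C M M" using cmp_Hom[OF p kD(1)] .
    \<comment> \<open>D_i is to be the image of the idempotent \<open>d i \<odot> p\<close>. Since
      \<open>p\<close> is epi, this endomorphism has the same cokernel as
      \<open>d i\<close>.\<close>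
    have "is_cokernel C (d i \<odot> p) q"
    proof (rule is_cokernelI[OF qD(1,2) dp])
      show "q \<odot> (d i \<odot> p) = zero C M (cod C q)"
        using cmp_assoc[OF p kD(1) q] kD(3) cmp_zero_left[OF p] Hom_obj[OF q] by simp
      fix X g assume g: "g \<in> Hom C M X" "g \<odot> (d i \<odot> p) = zero C M X"
      have "g \<odot> d i \<odot> p = zero C M X" using cmp_assoc[OF p kD(1) g(1)] g(2) by simp
      then show "\<exists>h \<in> Hom C (cod C q) X. g = h \<odot> q"
        using is_epi_zeroD[OF pE p cmp_Hom[OF kD(1) g(1)]] qD(4)[OF g(1)] by blast
    qed
    then have "is_image C (d i \<odot> p) (d i)" using k(1) unfolding is_image_def by blast
    then show ?thesis using q k(2) l ql dp by blast
  qed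
  then have ex: "\<forall>i \<in> I. \<exists>qf. fst qf \<in> Hom C M (cod C (fst qf)) \<and> is_cokernel C (d i) (fst qf) \<and>
      (\<exists>l \<in> Hom C (cod C (fst qf)) M. fst qf \<odot> l = ident C (cod C (fst qf))) \<and>
      snd qf \<in> Hom C M M \<and> is_image C (snd qf) (d i)" by simp
  obtain qf where qf: "\<forall>i \<in> I. fst (qf i) \<in> Hom C M (cod C (fst (qf i))) \<and> is_cokernel C (d i) (fst (qf i)) \<and>
      (\<exists>l \<in> Hom C (cod C (fst (qf i))) M. fst (qf i) \<odot> l = ident C (cod C (fst (qf i)))) \<and>
      snd (qf i) \<in> Hom C M M \<and> is_image C (snd (qf i)) (d i)"
    using bchoice[OF ex] by (rule exE)
  define q where "q = (\<lambda>i. fst (qf i))"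
  define f where "f = (\<lambda>i. snd (qf i))"
  have q: "q i \<in> Hom C M (cod C (q i))" "is_cokernel C (d i) (q i)"
    "\<exists>l \<in> Hom C (cod C (q i)) M. q i \<odot> l = ident C (cod C (q i))"
    and f: "f i \<in> Hom C M M" "is_image C (f i) (d i)" if "i \<in> I" for i
    using qf that unfolding q_def f_def by blast+
  have "\<forall>i \<in> I. \<exists>c. is_cokernel C (s i) c" using s subobjectD(2) ex_cokernel_Hom by blast
  then obtain c where c: "\<forall>i \<in> I. is_cokernel C (s i) (c i)" by (rule bchoice[THEN exE])
  have cH: "c i \<in> Hom C M (cod C (c i))" "is_epi C (c i)" if "i \<in> I" for i
    using is_cokernelD(1,2) c s subobjectD(2) that by blast+
  obtain l e where l: "is_sum C M {j. \<exists>i \<in> I. is_image C (f i) j} l" and e: "P e" "lies_above C M l e"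
    using baer I f by blast
  have l': "is_sum C M (d ` I) l" using is_sum_images[of I f M M d] f l by simp
  have sl: "subobject C M l" using l unfolding is_sum_def by blast
  obtain cl where cl: "is_cokernel C l cl" using ex_cokernel_Hom[OF subobjectD(2)[OF sl]] by blast
  \<comment> \<open>Coproducts are products in the opposite category, so the quotients M/S_i have an
    intersection there; the kernel of that quotient is the sum of the S_i.\<close>
  have "\<exists>k. is_intersection (opcat C) M (c ` I) k"
  proof (rule op.ex_intersection[OF _ I])
    show "AB3_star (opcat C) U" "M \<in> obj (opcat C)" using assms by simp_all
    show "subobject (opcat C) M (c i)" if "i \<in> I" for i
      using cH[OF that] HomD(2) by (fastforce simp: subobject_opcat)
  qed
  then obtain ck where ck': "is_intersection (opcat C) M (c ` I) ck" by blast
  then have ckE: "is_epi C ck" and ckH: "ck \<in> Hom C M (cod C ck)"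
    by (auto simp: is_intersection_def subobject_opcat is_epi_def Hom_def)
  obtain k where k: "is_kernel C ck k" using ex_kernel_Hom[OF ckH] by blast
  have ck: "is_cokernel C k ck" using is_cokernel_kernel[OF ckE k] .
  have sk: "subobject C M k" using is_kernel_subobject[OF k ckH] .
  have k': "is_sum C M (s ` I) k"
    using is_sum_iff_intersection_opcat[of I M s c k ck] s c sk ck ck' by blast
  have cl': "is_intersection (opcat C) M (q ` I) cl"
    using is_sum_iff_intersection_opcat[of I M d q l cl] sd q(2) sl cl l' by blast
  have sr: "subobject C M r" using rad(2) unfolding superfluous_def by blast
  obtain cr where cr: "is_cokernel C r cr" using ex_cokernel_Hom[OF subobjectD(2)[OF sr]] by blast
  note crD = is_cokernelD[OF cr subobjectD(2)[OF sr]]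
  have "\<exists>t \<in> Hom (opcat C) (dom (opcat C) ck) (dom (opcat C) cl).
      ck = cl \<odot>\<^bsub>opcat C\<^esub> t \<and> essential_mono (opcat C) t"
  proof (rule op.essential_intersection[OF _ _ _ _ _ _ ck' cl'])
    show "subobject (opcat C) M cr"
      using crD(1,2) HomD(2) by (fastforce simp: subobject_opcat)
    show "essential_mono (opcat C) cr" using superfluous_iff[OF sr cr] rad(2) by blast
    show "sub_le (opcat C) cr a" if a: "subobject (opcat C) M a" "essential_mono (opcat C) a" for a
    proof -
      have aH: "is_epi C a" "a \<in> Hom C M (cod C a)"
        using a(1) by (auto simp: subobject_opcat is_epi_def Hom_def)
      obtain x where x: "is_kernel C a x" using ex_kernel_Hom[OF aH(2)] by blast
      have sx: "subobject C M x" using is_kernel_subobject[OF x aH(2)] .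
      have xa: "is_cokernel C x a" using is_cokernel_kernel[OF aH(1) x] .
      have "sub_le C x r" using superfluous_le_radical[OF rad(1) sx xa a(2)] .
      then show ?thesis using sub_le_opcat_cokernels[OF sx xa sr cr] by blast
    qed
    fix i assume i: "i \<in> I"
    show "q i \<in> Hom (opcat C) (dom (opcat C) (q i)) M" using q(1)[OF i] by simp
    show "\<exists>p \<in> Hom (opcat C) M (dom (opcat C) (q i)).
        p \<odot>\<^bsub>opcat C\<^esub> q i = ident (opcat C) (dom (opcat C) (q i))" using q(3)[OF i] by simp
    have "\<exists>t \<in> Hom C (cod C (q i)) (cod C (c i)). c i = t \<odot> q i \<and> essential_mono (opcat C) t"
      using lies_above_iff[OF _ sd[OF i] q(2)[OF i]] c s d i by blast
    then show "\<exists>a \<in> Hom (opcat C) (dom (opcat C) (c i)) (dom (opcat C) (q i)).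
        c i = q i \<odot>\<^bsub>opcat C\<^esub> a \<and> essential_mono (opcat C) a" by simp
  qed
  then have "lies_above C M k l" using lies_above_iff[OF sk sl cl ck] by simp
  then have "lies_above C M k e" using lies_above_trans e(2) by blast
  then show "\<exists>l. is_sum C M (s ` I) l \<and> (\<exists>d. P d \<and> lies_above C M l d)"
    using k' e(1) by blast
qed

end

theorem corollary7p4:
  fixes C :: "('o, 'm) cat" and U :: "'i set" and M :: 'o
  assumes "abelian_category C" and "infinite U" and "M \<in> obj C"
  shows
    "(AB3_star C U \<longrightarrow>
        (self_CS_Rickart C M \<and> SSIP_extending C U M \<longrightarrow> self_CS_Baer C U M) \<and>
        (strongly_self_CS_Rickart C M \<and> strictly_SSIP_extending C U M \<longrightarrow>
           strongly_self_CS_Baer C U M) \<and>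
        ((\<exists>s. is_socle C M s \<and> essential C M s) \<longrightarrow>
           (self_CS_Baer C U M \<longrightarrow> self_CS_Rickart C M \<and> SSIP_extending C U M) \<and>
           (strongly_self_CS_Baer C U M \<longrightarrow>
              strongly_self_CS_Rickart C M \<and> strictly_SSIP_extending C U M)))
     \<and>
     (AB3 C U \<longrightarrow>
        (dual_self_CS_Rickart C M \<and> SSSP_lifting C U M \<longrightarrow> dual_self_CS_Baer C U M) \<and>
        (dual_strongly_self_CS_Rickart C M \<and> strictly_SSSP_lifting C U M \<longrightarrow>
           dual_strongly_self_CS_Baer C U M) \<and>
        ((\<exists>r. is_radical C M r \<and> superfluous C M r) \<longrightarrow>
           (dual_self_CS_Baer C U M \<longrightarrow> dual_self_CS_Rickart C M \<and> SSSP_lifting C U M) \<and>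
           (dual_strongly_self_CS_Baer C U M \<longrightarrow>
              dual_strongly_self_CS_Rickart C M \<and> strictly_SSSP_lifting C U M)))"
proof -
  interpret abelian_category C by fact
  let ?fi = "\<lambda>d. direct_summand C M d \<and> fully_invariant C M d"
  \<comment> \<open>Both versions are put in the shape of some \<open>d\<close> with
    \<open>P d\<close>, to match the predicate variable of the converse lemmas.\<close>
  have fi: "ess_in_fi_summand C M = (\<lambda>k. \<exists>d. ?fi d \<and> essential_in C k d)"
    "above_fi_summand C M = (\<lambda>l. \<exists>d. ?fi d \<and> lies_above C M l d)"
    by (auto simp: fun_eq_iff ess_in_fi_summand_def above_fi_summand_def)
  have nofi: "ess_in_summand C M = (\<lambda>k. \<exists>d. direct_summand C M d \<and> essential_in C k d)"
    "above_summand C M = (\<lambda>l. \<exists>d. direct_summand C M d \<and> lies_above C M l d)"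
    by (auto simp: fun_eq_iff ess_in_summand_def above_summand_def)
  have drop_fi: "ess_in_fi_summand C M k \<Longrightarrow> ess_in_summand C M k"
    "above_fi_summand C M k \<Longrightarrow> above_summand C M k" for k
    by (auto simp: fi nofi)
  have sub: "subobject C M d" if "direct_summand C M d" for d
    using that by (simp add: direct_summand_def)
  have fwd1: "self_CS_Baer C U M" if "self_CS_Rickart C M" "SSIP_extending C U M"
    using CS_Baer_of_CS_Rickart[of M "ess_in_summand C M" "ess_in_summand C M" U] that
    unfolding self_CS_Rickart_def SSIP_extending_def self_CS_Baer_def by blast
  have bwd1: "self_CS_Rickart C M \<and> SSIP_extending C U M"
    if "AB3_star C U" "is_socle C M r" "essential C M r" "self_CS_Baer C U M" for r
  proof
    show "self_CS_Rickart C M"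
      using CS_Rickart_of_CS_Baer[OF assms(2)] that(4) unfolding self_CS_Rickart_def self_CS_Baer_def by blast
    show "SSIP_extending C U M"
      using SSIP_of_CS_Baer[OF that(1) assms(3) that(2,3), of "direct_summand C M"] that(4) sub
      unfolding SSIP_extending_def self_CS_Baer_def nofi(1) by blast
  qed
  have fwd2: "strongly_self_CS_Baer C U M" if "strongly_self_CS_Rickart C M" "strictly_SSIP_extending C U M"
    using CS_Baer_of_CS_Rickart[of M "ess_in_fi_summand C M" "ess_in_summand C M" U] that drop_fi(1)
    unfolding strongly_self_CS_Rickart_def strictly_SSIP_extending_def strongly_self_CS_Baer_def by blast
  have bwd2: "strongly_self_CS_Rickart C M \<and> strictly_SSIP_extending C U M"
    if "AB3_star C U" "is_socle C M r" "essential C M r" "strongly_self_CS_Baer C U M" for r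
  proof
    show "strongly_self_CS_Rickart C M"
      using CS_Rickart_of_CS_Baer[OF assms(2)] that(4) unfolding strongly_self_CS_Rickart_def strongly_self_CS_Baer_def by blast
    show "strictly_SSIP_extending C U M"
      using SSIP_of_CS_Baer[OF that(1) assms(3) that(2,3), of "?fi"] that(4) sub
      unfolding strictly_SSIP_extending_def strongly_self_CS_Baer_def fi(1) by blast
  qed
  have fwd3: "dual_self_CS_Baer C U M" if "dual_self_CS_Rickart C M" "SSSP_lifting C U M"
    using dual_CS_Baer_of_dual_CS_Rickart[of M "above_summand C M" "above_summand C M" U] that
    unfolding dual_self_CS_Rickart_def SSSP_lifting_def dual_self_CS_Baer_def by blast
  have bwd3: "dual_self_CS_Rickart C M \<and> SSSP_lifting C U M"
    if "AB3 C U" "is_radical C M r" "superfluous C M r" "dual_self_CS_Baer C U M" for r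
  proof
    show "dual_self_CS_Rickart C M"
      using dual_CS_Rickart_of_dual_CS_Baer[OF assms(2)] that(4) unfolding dual_self_CS_Rickart_def dual_self_CS_Baer_def by blast
    show "SSSP_lifting C U M"
      using SSSP_of_dual_CS_Baer[OF that(1) assms(3) that(2,3), of "direct_summand C M"] that(4) sub
      unfolding SSSP_lifting_def dual_self_CS_Baer_def nofi(2) by blast
  qed
  have fwd4: "dual_strongly_self_CS_Baer C U M" if "dual_strongly_self_CS_Rickart C M" "strictly_SSSP_lifting C U M"
    using dual_CS_Baer_of_dual_CS_Rickart[of M "above_fi_summand C M" "above_summand C M" U] that drop_fi(2)
    unfolding dual_strongly_self_CS_Rickart_def strictly_SSSP_lifting_def dual_strongly_self_CS_Baer_def by blast
  have bwd4: "dual_strongly_self_CS_Rickart C M \<and> strictly_SSSP_lifting C U M"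
    if "AB3 C U" "is_radical C M r" "superfluous C M r" "dual_strongly_self_CS_Baer C U M" for r
  proof
    show "dual_strongly_self_CS_Rickart C M"
      using dual_CS_Rickart_of_dual_CS_Baer[OF assms(2)] that(4) unfolding dual_strongly_self_CS_Rickart_def dual_strongly_self_CS_Baer_def by blast
    show "strictly_SSSP_lifting C U M"
      using SSSP_of_dual_CS_Baer[OF that(1) assms(3) that(2,3), of "?fi"] that(4) sub
      unfolding strictly_SSSP_lifting_def dual_strongly_self_CS_Baer_def fi(2) by blast
  qed
  show ?thesis
    using fwd1 fwd2 fwd3 fwd4 bwd1 bwd2 bwd3 bwd4 by blast
qed

end
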